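(* Let $\{x_n\}_{n\ge 1}$ be a sequence of points in $[0,1]$ and let $\varphi\colon\mathbb{N}\to(0,1]$ be a positive function. Then for any $x\in(0,1]$, the set $$E_x(\{x_n\},\varphi)=\{\beta>1\colon |T_\beta^n x-x_n|<\varphi(n)\text{ for infinitely many }n\in\mathbb{N}\}$$ has Lebesgue measure zero if $\sum_{n\ge1}\varphi(n)<+\infty$, and has full Lebesgue measure in $(1,+\infty)$ (i.e. its complement in $(1,+\infty)$ is Lebesgue null) if $\sum_{n\ge1}\varphi(n)=+\infty$.
   Context: $\mathbb{N}=\{1,2,\dots\}$. For $\beta>1$, the beta-transformation $T_\beta\colon[0,1]\to[0,1]$ is $T_\beta(x)=\beta x-\lfloor\beta x\rfloor$ for all $x\in[0,1]$ (including $x=1$), where $\lfloor\cdot\rfloor$ is the integer part; $T_\beta^n$ is its $n$-th iterate. *)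

theory Defs
  imports "HOL-Analysis.Analysis"
begin

text \<open>The map is defined on all of the reals. For \<open>\<beta> > 1\<close> it sends \<open>[0,1]\<close> into \<open>[0,1)\<close>, so its
  iterates at points of \<open>[0,1]\<close> are those of the transformation of \<open>[0,1]\<close>. At \<open>x = 1\<close> the value is
  \<open>\<beta> - \<lfloor>\<beta>\<rfloor>\<close>.\<close>

definition beta_transformation :: "real \<Rightarrow> real \<Rightarrow> real" where
  "beta_transformation \<beta> x = \<beta> * x - of_int \<lfloor>\<beta> * x\<rfloor>"

text \<open>The indices \<open>n\<close> range over the positive integers; the values \<open>xs 0\<close> and \<open>\<phi> 0\<close> play no role.\<close>

definition shrinking_target_params ::
    "real \<Rightarrow> (nat \<Rightarrow> real) \<Rightarrow> (nat \<Rightarrow> real) \<Rightarrow> real set" where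
  "shrinking_target_params x xs \<phi> =
     {\<beta>. \<beta> > 1 \<and> infinite {n. n \<ge> 1 \<and> \<bar>(beta_transformation \<beta> ^^ n) x - xs n\<bar> < \<phi> n}}"

end

theory Submission
  imports Defs
begin

text \<open>Fix \<open>x\<close> and write \<open>f n \<beta>\<close> for the \<open>n\<close>-th iterate of \<open>x\<close> under the beta-transformation. Everything rests on
the shape of \<open>f n\<close> as a function of \<open>\<beta>\<close>. Its zeros cut the line into branches, and along a branch all
digits are constant, so that \<open>f n\<close> is continuous and increasing there with slope comparable to \<open>\<beta> ^ n\<close>
(\<open>lift_diff_lower\<close>, \<open>lift_diff_upper\<close>, \<open>same_digits_if_no_zero\<close>). Hence the branch that starts at \<open>p\<close> has
length \<open>O(1 / p ^ n)\<close> and contains an \<open>O(r / p ^ n)\<close> portion of parameters at which \<open>f n\<close> lies within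
\<open>r\<close> of a given point.

It remains to control the sum of \<open>1 / p ^ n\<close> over the starting points \<open>p\<close> in an interval \<open>L\<close>. A zero of
\<open>f (n+1)\<close> that is a zero of \<open>f n\<close> already contributes at most a fixed fraction of what it contributed
before. A new zero, other than the leftmost zero in \<open>L\<close>, ends a full branch, on which \<open>f (n+1)\<close> runs through all of \<open>[0,1)\<close>; such a branch
has length at least a constant times \<open>1 / z ^ (n+1)\<close>, and these branches are disjoint, so these zeros
together contribute \<open>O(|L|)\<close>. The contraction \<open>branch_weight_Suc_le\<close> results: the total weight is
\<open>O(|L|)\<close> up to an exponentially small error. With the first Borel--Cantelli lemma this settles the
convergent case.

In the divergent case let \<open>E n\<close> be the set of parameters in \<open>L\<close> that hit the \<open>n\<close>-th target. The full
branches fill a fixed proportion of \<open>L\<close> once \<open>n\<close> is large (\<open>new_weight_lower\<close>), so \<open>E n\<close> has measure at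
least a constant times \<open>\<phi> n |L|\<close>. Each piece of \<open>E m\<close> lies in an interval of length \<open>O(\<phi> m / p ^ m)\<close> inside
one branch, and the weight bound applied to this interval shows that \<open>E m\<close> and \<open>E n\<close> are independent
up to a constant factor and an error that decays exponentially in \<open>n - m\<close> (\<open>measure_hits_Int_le\<close>). The
second moment method then gives the limit superior a proportion of \<open>L\<close> that is bounded below by one
constant for all \<open>L\<close> in a compact range of parameters, and a set with this property has full measure
(\<open>null_set_if_dense_on_intervals\<close>).\<close>
section \<open>Orbits as functions of the parameter\<close>

definition param_orbit :: "real \<Rightarrow> nat \<Rightarrow> real \<Rightarrow> real" where
  "param_orbit x n \<beta> = (beta_transformation \<beta> ^^ n) x"

lemma param_orbit_0 [simp]: "param_orbit x 0 \<beta> = x"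
  by (simp add: param_orbit_def)

lemma param_orbit_Suc: "param_orbit x (Suc n) \<beta> = frac (\<beta> * param_orbit x n \<beta>)"
  by (simp add: param_orbit_def beta_transformation_def frac_def)

lemma borel_measurable_param_orbit [measurable]: "param_orbit x n \<in> borel_measurable borel"
proof (induction n)
  case 0
  have "param_orbit x 0 = (\<lambda>_. x)" by (rule ext) simp
  then show ?case by simp
next
  case (Suc n)
  have "param_orbit x (Suc n) =
      (\<lambda>\<beta>. \<beta> * param_orbit x n \<beta> - of_int \<lfloor>\<beta> * param_orbit x n \<beta>\<rfloor>)"
    by (rule ext) (simp add: param_orbit_Suc frac_def)
  then show ?case using Suc by simp
qed

locale beta_family =
  fixes x :: real
  assumes x_pos: "0 < x" and x_le: "x \<le> 1"
begin

abbreviation f :: "nat \<Rightarrow> real \<Rightarrow> real" where "f \<equiv> param_orbit x"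

lemma f_nonneg: "0 \<le> f n \<beta>"
  using x_pos by (cases n) (auto simp: param_orbit_Suc)

lemma f_le_1: "f n \<beta> \<le> 1"
  using x_le by (cases n) (auto simp: param_orbit_Suc intro: less_imp_le frac_lt_1)

lemma zero_Suc: "f n \<beta> = 0 \<Longrightarrow> f (Suc n) \<beta> = 0"
  by (simp add: param_orbit_Suc)

text \<open>The integers compared are the first \<open>n\<close> digits of the beta-expansions of \<open>x\<close> in the bases \<open>\<beta>\<close> and \<open>\<gamma>\<close>.\<close>
definition same_digits :: "nat \<Rightarrow> real \<Rightarrow> real \<Rightarrow> bool" where
  "same_digits n \<beta> \<gamma> \<longleftrightarrow> (\<forall>k<n. \<lfloor>\<beta> * f k \<beta>\<rfloor> = \<lfloor>\<gamma> * f k \<gamma>\<rfloor>)"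

lemma same_digits_0 [simp]: "same_digits 0 \<beta> \<gamma>"
  by (simp add: same_digits_def)

lemma same_digits_Suc:
  "same_digits (Suc n) \<beta> \<gamma> \<longleftrightarrow> same_digits n \<beta> \<gamma> \<and> \<lfloor>\<beta> * f n \<beta>\<rfloor> = \<lfloor>\<gamma> * f n \<gamma>\<rfloor>"
  by (auto simp: same_digits_def less_Suc_eq)

lemma same_digits_trans: "same_digits n \<alpha> \<beta> \<Longrightarrow> same_digits n \<alpha> \<gamma> \<Longrightarrow> same_digits n \<beta> \<gamma>"
  by (simp add: same_digits_def)

lemma f_Suc_diff:
  assumes "same_digits (Suc n) \<beta> \<gamma>"
  shows "f (Suc n) \<gamma> - f (Suc n) \<beta> = \<gamma> * f n \<gamma> - \<beta> * f n \<beta>"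
  using assms by (simp add: same_digits_Suc param_orbit_Suc frac_def)

text \<open>The function \<open>\<beta> * f n \<beta>\<close> is a lift of \<open>f (Suc n)\<close> from the circle to the line. When the digits agree, passing from one lift
to the next multiplies increments by the base and adds a nonnegative term that comes from varying the
base itself. The multiplication alone gives the lower bound, and bounding \<open>f\<close> by 1 in the added term gives a geometric
series as the upper bound. Working with increments avoids derivatives.\<close>
lemma lift_diff_lower:
  assumes "1 < \<beta>" "\<beta> \<le> \<gamma>" "same_digits n \<beta> \<gamma>"
  shows "x * \<beta> ^ n * (\<gamma> - \<beta>) \<le> \<gamma> * f n \<gamma> - \<beta> * f n \<beta>"
  using assms(3)
proof (induction n)
  case 0
  show ?case by (simp add: algebra_simps)
next
  case (Suc n)
  have "x * \<beta> ^ Suc n * (\<gamma> - \<beta>) = \<beta> * (x * \<beta> ^ n * (\<gamma> - \<beta>))" by simp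
  also have "\<dots> \<le> \<beta> * (\<gamma> * f n \<gamma> - \<beta> * f n \<beta>)"
    using Suc assms by (intro mult_left_mono) (auto simp: same_digits_Suc)
  also have "\<dots> = \<beta> * (f (Suc n) \<gamma> - f (Suc n) \<beta>)"
    using f_Suc_diff[OF Suc.prems] by simp
  also have "\<dots> \<le> \<beta> * (f (Suc n) \<gamma> - f (Suc n) \<beta>) + (\<gamma> - \<beta>) * f (Suc n) \<gamma>"
    using assms f_nonneg by simp
  also have "\<dots> = \<gamma> * f (Suc n) \<gamma> - \<beta> * f (Suc n) \<beta>" by (simp add: algebra_simps)
  finally show ?case .
qed

lemma lift_diff_upper:
  assumes "1 < \<beta>" "\<beta> \<le> \<gamma>" "same_digits n \<beta> \<gamma>"
  shows "\<gamma> * f n \<gamma> - \<beta> * f n \<beta> \<le> (\<gamma> - \<beta>) * (\<gamma> ^ Suc n / (\<gamma> - 1))"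
proof -
  have "\<gamma> * f n \<gamma> - \<beta> * f n \<beta> \<le> (\<gamma> - \<beta>) * (\<Sum>i\<le>n. \<gamma> ^ i)"
    using assms(3)
  proof (induction n)
    case 0
    have "(\<gamma> - \<beta>) * x \<le> \<gamma> - \<beta>" using assms x_le by (simp add: mult_left_le)
    then show ?case by (simp add: algebra_simps)
  next
    case (Suc n)
    have "\<gamma> * f (Suc n) \<gamma> - \<beta> * f (Suc n) \<beta>
        = \<gamma> * (f (Suc n) \<gamma> - f (Suc n) \<beta>) + (\<gamma> - \<beta>) * f (Suc n) \<beta>" by (simp add: algebra_simps)
    also have "\<dots> \<le> \<gamma> * ((\<gamma> - \<beta>) * (\<Sum>i\<le>n. \<gamma> ^ i)) + (\<gamma> - \<beta>) * 1"
      using Suc assms f_le_1[of "Suc n" \<beta>] f_Suc_diff[OF Suc.prems]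
      by (intro add_mono mult_left_mono) (auto simp: same_digits_Suc)
    also have "\<dots> = (\<gamma> - \<beta>) * (\<Sum>i\<le>Suc n. \<gamma> ^ i)"
      by (subst sum.atMost_Suc_shift) (simp add: sum_distrib_left algebra_simps)
    finally show ?case .
  qed
  also have "(\<Sum>i\<le>n. \<gamma> ^ i) = (\<gamma> ^ Suc n - 1) / (\<gamma> - 1)"
    using assms by (subst lessThan_Suc_atMost[symmetric]) (simp only: geometric_sum)
  also have "(\<gamma> - \<beta>) * \<dots> \<le> (\<gamma> - \<beta>) * (\<gamma> ^ Suc n / (\<gamma> - 1))"
    using assms by (intro mult_left_mono divide_right_mono) auto
  finally show ?thesis .
qed

section \<open>Zeros of the orbit functions cut the parameter line into monotone branches\<close>

lemma continuous_on_f: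
  assumes "\<And>\<delta>. \<delta> \<in> S \<Longrightarrow> same_digits n \<beta> \<delta>"
  shows "continuous_on S (f n)"
  using assms
proof (induction n)
  case 0
  have "f 0 = (\<lambda>_. x)" by (rule ext) simp
  then show ?case by simp
next
  case (Suc n)
  then have "continuous_on S (f n)" by (simp add: same_digits_Suc)
  then have "continuous_on S (\<lambda>\<delta>. \<delta> * f n \<delta> - of_int \<lfloor>\<beta> * f n \<beta>\<rfloor>)"
    by (intro continuous_intros)
  moreover have "f (Suc n) \<delta> = \<delta> * f n \<delta> - of_int \<lfloor>\<beta> * f n \<beta>\<rfloor>" if "\<delta> \<in> S" for \<delta>
    using Suc.prems[OF that] by (simp add: same_digits_Suc param_orbit_Suc frac_def)
  ultimately show ?case by (simp cong: continuous_on_cong)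
qed

lemma lift_strict_mono:
  assumes "1 < \<beta>" "\<beta> < \<gamma>" "same_digits n \<beta> \<gamma>"
  shows "\<beta> * f n \<beta> < \<gamma> * f n \<gamma>"
proof -
  have "0 < x * \<beta> ^ n * (\<gamma> - \<beta>)" using assms x_pos by simp
  also have "\<dots> \<le> \<gamma> * f n \<gamma> - \<beta> * f n \<beta>" using assms by (intro lift_diff_lower) auto
  finally show ?thesis by simp
qed

text \<open>Zeros of \<open>f (Suc n)\<close> are the points where the lift takes an integer value; they are found by the
intermediate value theorem.\<close>
lemma lift_hits_integer:
  assumes \<beta>: "1 < \<beta>" "\<beta> \<le> \<gamma>" and dig: "\<And>\<delta>. \<beta> \<le> \<delta> \<Longrightarrow> \<delta> \<le> \<gamma> \<Longrightarrow> same_digits n \<beta> \<delta>"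
    and j: "\<beta> * f n \<beta> < of_int j" "of_int j \<le> \<gamma> * f n \<gamma>"
  obtains \<zeta> where "\<beta> < \<zeta>" "\<zeta> \<le> \<gamma>" "\<zeta> * f n \<zeta> = of_int j" "f (Suc n) \<zeta> = 0"
proof -
  have "continuous_on {\<beta>..\<gamma>} (\<lambda>\<delta>. \<delta> * f n \<delta>)"
    using dig by (intro continuous_intros continuous_on_f) auto
  from IVT'[OF less_imp_le[OF j(1)] j(2) \<beta>(2) this]
  obtain \<zeta> where \<zeta>: "\<beta> \<le> \<zeta>" "\<zeta> \<le> \<gamma>" "\<zeta> * f n \<zeta> = of_int j" by blast
  with j have "\<zeta> \<noteq> \<beta>" by auto
  with \<zeta> show ?thesis by (intro that[of \<zeta>]) (auto simp: param_orbit_Suc)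
qed

text \<open>If a digit changed, the lift, being continuous and increasing as long as the earlier digits are constant,
would have passed through an integer, which is a zero.\<close>
lemma same_digits_if_no_zero:
  assumes \<beta>: "1 < \<beta>" "\<beta> \<le> \<gamma>" and nz: "\<And>\<delta>. \<beta> < \<delta> \<Longrightarrow> \<delta> \<le> \<gamma> \<Longrightarrow> f n \<delta> \<noteq> 0"
  shows "same_digits n \<beta> \<gamma>"
  using \<beta>(2) nz
proof (induction n arbitrary: \<gamma>)
  case 0
  show ?case by simp
next
  case (Suc n)
  have dig: "same_digits n \<beta> \<delta>" if "\<beta> \<le> \<delta>" "\<delta> \<le> \<gamma>" for \<delta>
  proof (rule Suc.IH[OF that(1)])
    fix \<eta> assume "\<beta> < \<eta>" "\<eta> \<le> \<delta>"
    then show "f n \<eta> \<noteq> 0" using Suc.prems(2)[of \<eta>] that zero_Suc by fastforce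
  qed
  have mono: "\<beta> * f n \<beta> \<le> \<gamma> * f n \<gamma>"
    using lift_strict_mono[OF \<beta>(1) _ dig] Suc.prems(1) by (cases "\<beta> = \<gamma>") (auto simp: less_imp_le)
  have "\<lfloor>\<beta> * f n \<beta>\<rfloor> = \<lfloor>\<gamma> * f n \<gamma>\<rfloor>"
  proof (rule ccontr)
    assume "\<lfloor>\<beta> * f n \<beta>\<rfloor> \<noteq> \<lfloor>\<gamma> * f n \<gamma>\<rfloor>"
    with floor_mono[OF mono] have "\<lfloor>\<beta> * f n \<beta>\<rfloor> < \<lfloor>\<gamma> * f n \<gamma>\<rfloor>" by simp
    then have "\<beta> * f n \<beta> < of_int \<lfloor>\<gamma> * f n \<gamma>\<rfloor>" by (simp add: floor_less_iff)
    from lift_hits_integer[OF \<beta>(1) Suc.prems(1) dig this of_int_floor_le]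
    obtain \<zeta> where "\<beta> < \<zeta>" "\<zeta> \<le> \<gamma>" "f (Suc n) \<zeta> = 0" by metis
    with Suc.prems(2) show False by blast
  qed
  with dig Suc.prems(1) show ?case by (simp add: same_digits_Suc)
qed

definition zeros :: "nat \<Rightarrow> real \<Rightarrow> real \<Rightarrow> real set" where
  "zeros n u w = {\<beta>. u < \<beta> \<and> \<beta> < w \<and> f n \<beta> = 0}"

lemma zeros_0 [simp]: "zeros 0 u w = {}"
  using x_pos by (auto simp: zeros_def)

lemma zeros_mono: "zeros n u w \<subseteq> zeros (Suc n) u w"
  by (auto simp: zeros_def zero_Suc)

text \<open>Two zeros with the same digit string would contradict strict monotonicity of \<open>f n\<close>, and only finitely
many digit strings occur for bounded bases.\<close>
lemma finite_zeros:
  assumes "1 < u"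
  shows "finite (zeros n u w)"
proof (cases n)
  case 0
  then show ?thesis by simp
next
  case (Suc m)
  define code where "code \<beta> = map (\<lambda>k. \<lfloor>\<beta> * f k \<beta>\<rfloor>) [0..<n]" for \<beta>
  have dig: "same_digits n \<beta> \<gamma>" if "code \<beta> = code \<gamma>" for \<beta> \<gamma>
    using that by (auto simp: same_digits_def code_def)
  have "inj_on code (zeros n u w)"
  proof (rule linorder_inj_onI)
    fix \<beta> \<gamma> assume \<beta>\<gamma>: "\<beta> < \<gamma>" "\<beta> \<in> zeros n u w" "\<gamma> \<in> zeros n u w"
    show "code \<beta> \<noteq> code \<gamma>"
    proof
      assume "code \<beta> = code \<gamma>"
      from dig[OF this] have d: "same_digits (Suc m) \<beta> \<gamma>" using Suc by simp
      then have "f (Suc m) \<gamma> - f (Suc m) \<beta> > 0"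
        using lift_strict_mono[of \<beta> \<gamma> m] \<beta>\<gamma> assms f_Suc_diff[OF d]
        by (simp add: zeros_def same_digits_Suc)
      with \<beta>\<gamma> Suc show False by (simp add: zeros_def)
    qed
  qed auto
  moreover have "code ` zeros n u w \<subseteq> {xs. set xs \<subseteq> {0..\<lfloor>w\<rfloor>} \<and> length xs = n}"
  proof -
    have "0 \<le> \<lfloor>\<beta> * f k \<beta>\<rfloor> \<and> \<lfloor>\<beta> * f k \<beta>\<rfloor> \<le> \<lfloor>w\<rfloor>" if "\<beta> \<in> zeros n u w" for \<beta> k
    proof -
      have "1 < \<beta>" "\<beta> < w" using that assms by (auto simp: zeros_def)
      then have "0 \<le> \<beta> * f k \<beta>" "\<beta> * f k \<beta> \<le> \<beta> * 1"
        using f_nonneg f_le_1 by (auto intro!: mult_left_mono)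
      then have "0 \<le> \<beta> * f k \<beta>" "\<beta> * f k \<beta> \<le> w" using \<open>\<beta> < w\<close> by auto
      then show ?thesis by (simp add: floor_mono)
    qed
    then show ?thesis by (auto simp: code_def)
  qed
  then have "finite (code ` zeros n u w)"
    by (rule finite_subset) (intro finite_lists_length_eq finite_atLeastAtMost_int)
  ultimately show ?thesis by (rule finite_imageD[rotated])
qed

text \<open>A zero \<open>z\<close> of \<open>f (Suc n)\<close> that is not inherited from \<open>f n\<close> ends a full branch: since no zero lies strictly
between \<open>y\<close> and \<open>z\<close>, the lift runs from one integer exactly to the next.\<close>
lemma new_zero_branch:
  assumes y: "1 < y" "y < z" "f (Suc n) y = 0" and z: "f (Suc n) z = 0" "f n z \<noteq> 0"
    and gap: "\<And>\<delta>. y < \<delta> \<Longrightarrow> \<delta> < z \<Longrightarrow> f (Suc n) \<delta> \<noteq> 0"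
  obtains j :: int where "\<And>\<delta>. y \<le> \<delta> \<Longrightarrow> \<delta> \<le> z \<Longrightarrow> same_digits n y \<delta>"
    "y * f n y = of_int j" "z * f n z = of_int j + 1"
    "\<And>\<delta>. y \<le> \<delta> \<Longrightarrow> \<delta> < z \<Longrightarrow> f (Suc n) \<delta> = \<delta> * f n \<delta> - of_int j"
proof -
  have dig: "same_digits n y \<delta>" if "y \<le> \<delta>" "\<delta> \<le> z" for \<delta>
  proof (rule same_digits_if_no_zero[OF y(1) that(1)])
    fix \<eta> assume "y < \<eta>" "\<eta> \<le> \<delta>"
    then show "f n \<eta> \<noteq> 0" using gap[of \<eta>] zero_Suc[of n \<eta>] z(2) that by (cases "\<eta> = z") auto
  qed
  obtain j where j: "y * f n y = of_int j"
    using y(3) by (auto simp: param_orbit_Suc elim!: Ints_cases)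
  obtain k where k: "z * f n z = of_int k"
    using z(1) by (auto simp: param_orbit_Suc elim!: Ints_cases)
  have "j < k" using lift_strict_mono[OF y(1,2) dig] j k y by simp
  have "k = j + 1"
  proof (rule ccontr)
    assume "k \<noteq> j + 1"
    with \<open>j < k\<close> have jk: "j + 1 < k" by simp
    have 1: "y * f n y < of_int (j + 1)" using j by simp
    have 2: "of_int (j + 1) \<le> z * f n z" unfolding k using jk by linarith
    obtain \<zeta> where \<zeta>: "y < \<zeta>" "\<zeta> \<le> z" "\<zeta> * f n \<zeta> = of_int (j + 1)" "f (Suc n) \<zeta> = 0"
      using lift_hits_integer[OF y(1) less_imp_le[OF y(2)] dig 1 2] by metis
    then have "\<zeta> = z" using gap by force
    with \<zeta>(3) k jk show False by simp
  qed
  moreover have "f (Suc n) \<delta> = \<delta> * f n \<delta> - of_int j" if "y \<le> \<delta>" "\<delta> < z" for \<delta>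
  proof -
    have "same_digits (Suc n) y \<delta>" using gap that y(1)
      by (intro same_digits_if_no_zero) auto
    then show ?thesis by (simp add: param_orbit_Suc frac_def same_digits_Suc j[symmetric])
                        (metis floor_of_int j)
  qed
  ultimately show ?thesis using that[of j] dig j k by auto
qed

end

section \<open>Counting branches\<close>

lemma fmeasurable_intervals [simp]:
  fixes u w :: real
  shows "{u<..<w} \<in> fmeasurable lborel" "{u..w} \<in> fmeasurable lborel"
    "{u, w} \<in> fmeasurable lborel"
proof -
  show *: "{u..w} \<in> fmeasurable lborel"
    by (auto intro!: fmeasurableI simp: emeasure_lborel_Icc_eq)
  show "{u<..<w} \<in> fmeasurable lborel"
    by (rule fmeasurableI2[OF *]) auto
  show "{u, w} \<in> fmeasurable lborel"
    by (auto intro!: fmeasurableI simp: emeasure_lborel_countable)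
qed

lemma hull_of_small_set:
  fixes S :: "real set"
  assumes "S \<noteq> {}" and d: "\<And>\<beta> \<gamma>. \<beta> \<in> S \<Longrightarrow> \<gamma> \<in> S \<Longrightarrow> \<beta> \<le> \<gamma> \<Longrightarrow> \<gamma> - \<beta> \<le> d"
  obtains a b where "S \<subseteq> {a..b}" "a \<le> b" "b - a \<le> d"
    "\<And>c. a < c \<Longrightarrow> c < b \<Longrightarrow> \<exists>\<beta>\<in>S. \<exists>\<gamma>\<in>S. \<beta> < c \<and> c < \<gamma>"
    "\<And>l. (\<And>\<beta>. \<beta> \<in> S \<Longrightarrow> l \<le> \<beta>) \<Longrightarrow> l \<le> a" "\<And>r. (\<And>\<beta>. \<beta> \<in> S \<Longrightarrow> \<beta> \<le> r) \<Longrightarrow> b \<le> r"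
proof
  obtain p where p: "p \<in> S" using assms by auto
  have "\<bar>\<beta> - p\<bar> \<le> d" if "\<beta> \<in> S" for \<beta>
    using d[OF that p] d[OF p that] by (cases "\<beta> \<le> p") auto
  then have bd: "\<beta> \<le> p + d" "p - d \<le> \<beta>" if "\<beta> \<in> S" for \<beta>
    using that by (force simp: abs_le_iff)+
  have bdd: "bdd_above S" "bdd_below S" using bd by (auto intro!: bdd_aboveI bdd_belowI)
  show "S \<subseteq> {Inf S..Sup S}" using bdd by (auto intro: cInf_lower cSup_upper)
  then show "Inf S \<le> Sup S" using p by auto
  show "\<exists>\<beta>\<in>S. \<exists>\<gamma>\<in>S. \<beta> < c \<and> c < \<gamma>" if "Inf S < c" "c < Sup S" for c
    using that bdd assms(1) by (simp add: cInf_less_iff less_cSup_iff)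
  show "l \<le> Inf S" if "\<And>\<beta>. \<beta> \<in> S \<Longrightarrow> l \<le> \<beta>" for l
    by (rule cInf_greatest[OF assms(1)], rule that)
  show "Sup S \<le> r" if "\<And>\<beta>. \<beta> \<in> S \<Longrightarrow> \<beta> \<le> r" for r
    by (rule cSup_least[OF assms(1)], rule that)
  have "Sup S \<le> d + Inf S"
  proof (rule cSup_least[OF assms(1)])
    fix \<gamma> assume \<gamma>: "\<gamma> \<in> S"
    have "\<gamma> - d \<le> Inf S"
    proof (rule cInf_greatest[OF assms(1)])
      fix \<beta> assume \<beta>: "\<beta> \<in> S"
      show "\<gamma> - d \<le> \<beta>" using d[OF \<beta> \<gamma>] d[OF p p] by (cases "\<beta> \<le> \<gamma>") auto
    qed
    then show "\<gamma> \<le> d + Inf S" by simp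
  qed
  then show "Sup S - Inf S \<le> d" by simp
qed

context beta_family
begin

text \<open>Requiring another zero in the interval ensures that the branch ending at a new zero starts at a zero, so
that it is full, and lies inside the interval.\<close>
definition new_zeros :: "nat \<Rightarrow> real \<Rightarrow> real \<Rightarrow> real set" where
  "new_zeros n u w = {z \<in> zeros (Suc n) u w. f n z \<noteq> 0 \<and> (\<exists>y\<in>zeros (Suc n) u w. y < z)}"

definition left_zero :: "nat \<Rightarrow> real \<Rightarrow> real \<Rightarrow> real \<Rightarrow> real" where
  "left_zero n u w z = Max {y \<in> zeros (Suc n) u w. y < z}"

lemma finite_new_zeros: "1 < u \<Longrightarrow> finite (new_zeros n u w)"
  unfolding new_zeros_def using finite_zeros by simp

lemma left_zero:
  assumes "1 < u" "z \<in> new_zeros n u w"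
  defines "y \<equiv> left_zero n u w z"
  shows "u < y" "y < z" "z < w" "f (Suc n) y = 0" "f (Suc n) z = 0" "f n z \<noteq> 0"
    "\<And>\<delta>. y < \<delta> \<Longrightarrow> \<delta> < z \<Longrightarrow> f (Suc n) \<delta> \<noteq> 0"
proof -
  let ?Y = "{y \<in> zeros (Suc n) u w. y < z}"
  have fin: "finite ?Y" using finite_zeros[OF assms(1)] by simp
  have "?Y \<noteq> {}" using assms(2) by (auto simp: new_zeros_def)
  then have y: "y \<in> ?Y" unfolding y_def left_zero_def using fin by (intro Max_in)
  then show "u < y" "y < z" "f (Suc n) y = 0" by (auto simp: zeros_def)
  show "z < w" "f (Suc n) z = 0" "f n z \<noteq> 0" using assms(2) by (auto simp: new_zeros_def zeros_def)
  fix \<delta> assume \<delta>: "y < \<delta>" "\<delta> < z"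
  show "f (Suc n) \<delta> \<noteq> 0"
  proof
    assume "f (Suc n) \<delta> = 0"
    with \<delta> \<open>u < y\<close> \<open>z < w\<close> have "\<delta> \<in> ?Y" by (auto simp: zeros_def)
    then have "\<delta> \<le> y" unfolding y_def left_zero_def using fin by (rule Max_ge[rotated])
    with \<delta> show False by simp
  qed
qed

lemma left_zero_separates:
  assumes "1 < u" "z \<in> new_zeros n u w" "z' \<in> new_zeros n u w" "z < z'"
  shows "z \<le> left_zero n u w z'"
proof (rule ccontr)
  assume "\<not> z \<le> left_zero n u w z'"
  then have "f (Suc n) z \<noteq> 0" using left_zero(7)[OF assms(1,3)] assms(4) by simp
  with left_zero(5)[OF assms(1,2)] show False by simp
qed

text \<open>The branches that end at new zeros are pairwise disjoint, so lower bounds for a set on each of them add up.\<close>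
lemma measure_new_branches:
  assumes u: "1 < u" "u \<le> w" and S: "S \<subseteq> {u<..<w}" "S \<in> sets borel"
    and c: "\<And>z. z \<in> new_zeros n u w \<Longrightarrow> c z \<le> measure lborel (S \<inter> {left_zero n u w z<..<z})"
  shows "(\<Sum>z\<in>new_zeros n u w. c z) \<le> measure lborel S"
proof -
  let ?I = "\<lambda>z. S \<inter> {left_zero n u w z<..<z}"
  have Sf: "S \<in> fmeasurable lborel"
    by (rule fmeasurableI2[of "{u<..<w}"]) (use S in auto)
  have fm: "?I z \<in> fmeasurable lborel" for z
    by (rule fmeasurableI2[of S]) (use Sf S in auto)
  have "pairwise (\<lambda>z z'. disjnt (?I z) (?I z')) (new_zeros n u w)"
  proof (intro pairwiseI)
    fix z z' assume z: "z \<in> new_zeros n u w" "z' \<in> new_zeros n u w" "z \<noteq> z'"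
    then show "disjnt (?I z) (?I z')"
      using left_zero_separates[OF u(1) z(1,2)] left_zero_separates[OF u(1) z(2,1)]
      by (cases z z' rule: linorder_cases) (auto simp: disjnt_def)
  qed
  then have "measure lborel (\<Union>z\<in>new_zeros n u w. ?I z)
      = (\<Sum>z\<in>new_zeros n u w. measure lborel (?I z))"
    using finite_new_zeros[OF u(1)] fm by (intro measure_UNION') auto
  moreover have "measure lborel (\<Union>z\<in>new_zeros n u w. ?I z) \<le> measure lborel S"
    using S Sf finite_new_zeros[OF u(1)] by (intro measure_mono_fmeasurable) auto
  moreover have "(\<Sum>z\<in>new_zeros n u w. c z) \<le> (\<Sum>z\<in>new_zeros n u w. measure lborel (?I z))"
    by (intro sum_mono c)
  ultimately show ?thesis by linarith
qed

text \<open>The weight \<open>1 / z ^ n\<close> is, up to constants, the length of a full branch of \<open>f n\<close> near \<open>z\<close>.\<close>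
definition zero_weight :: "nat \<Rightarrow> real \<Rightarrow> real \<Rightarrow> real" where
  "zero_weight n u w = (\<Sum>z\<in>zeros n u w. 1 / z ^ n)"

definition new_weight :: "nat \<Rightarrow> real \<Rightarrow> real \<Rightarrow> real" where
  "new_weight n u w = (\<Sum>z\<in>new_zeros n u w. 1 / z ^ Suc n)"

lemma zero_weight_nonneg: "1 < u \<Longrightarrow> 0 \<le> zero_weight n u w"
  unfolding zero_weight_def by (intro sum_nonneg) (auto simp: zeros_def)

lemma new_weight_nonneg: "1 < u \<Longrightarrow> 0 \<le> new_weight n u w"
  unfolding new_weight_def by (intro sum_nonneg) (auto simp: new_zeros_def zeros_def)

end

text \<open>Parameters are confined to a compact range \<open>[s\<^sup>2, M]\<close>, on which all constants are uniform. Writing the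
left end as a square leaves room to replace the natural contraction rate \<open>1 / s\<^sup>2\<close> by the weaker rate
\<open>1 / s\<close>, which absorbs the contribution of the incomplete branch at the left end of an interval.\<close>
locale beta_window = beta_family +
  fixes s M :: real
  assumes s_gt_1: "1 < s" and M_gt_1: "1 < M"
begin

definition in_window :: "real \<Rightarrow> real \<Rightarrow> bool" where
  "in_window u w \<longleftrightarrow> s\<^sup>2 \<le> u \<and> u \<le> w \<and> w \<le> M"

lemma s2_gt: "s < s\<^sup>2" "1 < s\<^sup>2"
  using s_gt_1 by (auto simp: power2_eq_square intro: less_trans[of 1 s])

lemma in_windowD: assumes "in_window u w" shows "1 < u" "s\<^sup>2 \<le> u" "u \<le> w" "w \<le> M" "0 < M" "1 < M"
  using assms s2_gt unfolding in_window_def by auto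

text \<open>On the branch ending at \<open>z\<close> the lift increases by exactly 1, while its slope is \<open>O(z ^ Suc n)\<close>.\<close>
lemma branch_length:
  assumes "in_window u w" "z \<in> new_zeros n u w"
  shows "(s\<^sup>2 - 1) * (1 / z ^ Suc n) \<le> z - left_zero n u w z"
proof -
  let ?y = "left_zero n u w z"
  note u = in_windowD[OF assms(1)]
  note y = left_zero[OF u(1) assms(2)]
  have "1 < ?y" using u y by simp
  then obtain j :: int where j: "\<And>\<delta>. ?y \<le> \<delta> \<Longrightarrow> \<delta> \<le> z \<Longrightarrow> same_digits n ?y \<delta>"
    "?y * f n ?y = of_int j" "z * f n z = of_int j + 1"
    using new_zero_branch[of ?y z n] y by metis
  have "1 = z * f n z - ?y * f n ?y" using j by simp
  also have "\<dots> \<le> (z - ?y) * (z ^ Suc n / (z - 1))"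
    using \<open>1 < ?y\<close> y j by (intro lift_diff_upper) auto
  also have "\<dots> \<le> (z - ?y) * (z ^ Suc n / (s\<^sup>2 - 1))"
    using \<open>1 < ?y\<close> y u s2_gt by (intro mult_left_mono divide_left_mono) auto
  finally show ?thesis using \<open>1 < ?y\<close> y s2_gt
    by (simp add: field_simps)
qed

lemma new_weight_le:
  assumes "in_window u w"
  shows "new_weight n u w \<le> (w - u) / (s\<^sup>2 - 1)"
proof -
  note u = in_windowD[OF assms]
  have "(\<Sum>z\<in>new_zeros n u w. (s\<^sup>2 - 1) * (1 / z ^ Suc n)) \<le> measure lborel {u<..<w}"
  proof (rule measure_new_branches[OF u(1,3)])
    fix z assume z: "z \<in> new_zeros n u w"
    note y = left_zero[OF u(1) z]
    have "{u<..<w} \<inter> {left_zero n u w z<..<z} = {left_zero n u w z<..<z}" using y by auto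
    then show "(s\<^sup>2 - 1) * (1 / z ^ Suc n) \<le> measure lborel ({u<..<w} \<inter> {left_zero n u w z<..<z})"
      using branch_length[OF assms z] y by simp
  qed auto
  also have "(\<Sum>z\<in>new_zeros n u w. (s\<^sup>2 - 1) * (1 / z ^ Suc n)) = (s\<^sup>2 - 1) * new_weight n u w"
    unfolding new_weight_def by (simp only: sum_distrib_left)
  finally show ?thesis using u s2_gt by (simp add: field_simps)
qed

text \<open>A zero of \<open>f (Suc n)\<close> is inherited from \<open>f n\<close>, or new with a zero to its left, or the leftmost zero in the
interval; the three terms account for these cases in this order.\<close>
lemma zero_weight_Suc_le:
  assumes "in_window u w"
  shows "zero_weight (Suc n) u w \<le> zero_weight n u w / s\<^sup>2 + new_weight n u w + 1 / u ^ Suc n"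
proof -
  note u = in_windowD[OF assms]
  let ?zeros = "zeros (Suc n) u w"
  have fin: "finite ?zeros" "finite (zeros n u w)" using finite_zeros[OF u(1)] by auto
  define m where "m = Min ?zeros"
  have pos: "0 \<le> 1 / z ^ Suc n" if "z \<in> ?zeros" for z using that u by (auto simp: zeros_def)
  have sub: "?zeros \<subseteq> zeros n u w \<union> new_zeros n u w \<union> ({m} \<inter> ?zeros)"
  proof
    fix z assume z: "z \<in> ?zeros"
    show "z \<in> zeros n u w \<union> new_zeros n u w \<union> ({m} \<inter> ?zeros)"
    proof (cases "z = m")
      case False
      have "m \<in> ?zeros" "m \<le> z" unfolding m_def using z fin by (auto intro!: Min_in Min_le)
      with False have "m \<in> ?zeros \<and> m < z" by simp
      with z show ?thesis by (auto simp: new_zeros_def zeros_def)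
    qed (use z in auto)
  qed
  have old: "(\<Sum>z\<in>zeros n u w. 1 / z ^ Suc n) \<le> zero_weight n u w / s\<^sup>2"
    unfolding zero_weight_def sum_divide_distrib
  proof (rule sum_mono)
    fix z assume "z \<in> zeros n u w"
    then have "s\<^sup>2 \<le> z" "0 < z" using u by (auto simp: zeros_def)
    then have "1 / z ^ n / z \<le> 1 / z ^ n / s\<^sup>2" using s2_gt by (intro divide_left_mono mult_pos_pos) auto
    then show "1 / z ^ Suc n \<le> 1 / z ^ n / s\<^sup>2" by (simp add: field_simps)
  qed
  have first: "(\<Sum>z\<in>{m} \<inter> ?zeros. 1 / z ^ Suc n) \<le> 1 / u ^ Suc n"
  proof (cases "m \<in> ?zeros")
    case True
    then have "u \<le> m" by (auto simp: zeros_def)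
    then have "1 / m ^ Suc n \<le> 1 / u ^ Suc n"
      using u by (intro divide_left_mono power_mono) (auto intro!: mult_pos_pos)
    with True show ?thesis by simp
  qed (use u in auto)
  have new: "new_zeros n u w \<subseteq> ?zeros" by (auto simp: new_zeros_def)
  have nn: "0 \<le> 1 / z ^ Suc n" if "z \<in> zeros n u w \<union> new_zeros n u w \<union> ({m} \<inter> ?zeros)" for z
    using that pos[of z] zeros_mono[of n u w] new by auto
  have "zero_weight (Suc n) u w \<le> (\<Sum>z\<in>zeros n u w \<union> new_zeros n u w \<union> ({m} \<inter> ?zeros). 1 / z ^ Suc n)"
    unfolding zero_weight_def using fin finite_new_zeros[OF u(1)] sub nn
    by (intro sum_mono2) auto
  also have "\<dots> \<le> (\<Sum>z\<in>zeros n u w \<union> new_zeros n u w. 1 / z ^ Suc n) + (\<Sum>z\<in>{m} \<inter> ?zeros. 1 / z ^ Suc n)"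
    using fin finite_new_zeros[OF u(1)] nn
    by (subst sum_Un) (auto intro!: sum_nonneg)
  also have "(\<Sum>z\<in>zeros n u w \<union> new_zeros n u w. 1 / z ^ Suc n)
      \<le> (\<Sum>z\<in>zeros n u w. 1 / z ^ Suc n) + new_weight n u w"
    using fin finite_new_zeros[OF u(1)] nn unfolding new_weight_def
    by (subst sum_Un) (auto intro!: sum_nonneg)
  finally show ?thesis using old first by simp
qed

text \<open>\<open>B\<close> is large enough that \<open>(1 + B) / s\<^sup>2 \<le> B / s\<close>, and \<open>A\<close> solves \<open>A = A / s + 1 / (s\<^sup>2 - 1)\<close>. These are the
two relations that close the recursion below.\<close>
definition B :: real where "B = s / (s - 1)"
definition A :: real where "A = s / ((s - 1) * (s\<^sup>2 - 1))"

lemma A_pos: "0 < A" and B_ge_1: "1 \<le> B"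
  using s_gt_1 s2_gt by (auto simp: A_def B_def)

text \<open>The term \<open>B / u ^ n\<close> stands for the incomplete branch that starts at the left end \<open>u\<close>. It also pays in
advance for the error \<open>1 / u ^ Suc n\<close> in \<open>zero_weight_Suc_le\<close>, so that the recursion for the sum has no
error term other than a multiple of the length.\<close>
definition branch_weight :: "nat \<Rightarrow> real \<Rightarrow> real \<Rightarrow> real" where
  "branch_weight n u w = zero_weight n u w + B / u ^ n"

lemma weight_le_branch_weight:
  "in_window u w \<Longrightarrow> zero_weight n u w + 1 / u ^ n \<le> branch_weight n u w"
  unfolding branch_weight_def using B_ge_1 in_windowD(1)[of u w]
  by (auto intro!: divide_right_mono)

lemma branch_weight_Suc_le:
  assumes "in_window u w"
  shows "branch_weight (Suc n) u w \<le> branch_weight n u w / s + (w - u) / (s\<^sup>2 - 1)"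
proof -
  note u = in_windowD[OF assms]
  have "zero_weight n u w / s\<^sup>2 \<le> zero_weight n u w / s"
    using s_gt_1 s2_gt zero_weight_nonneg[OF u(1)] by (intro divide_left_mono) auto
  moreover have "1 / u ^ Suc n + B / u ^ Suc n \<le> B / u ^ n / s"
  proof -
    have "B * s\<^sup>2 = B * s + B * (s - 1) * s" by (simp add: algebra_simps power2_eq_square)
    also have "B * (s - 1) = s" using s_gt_1 by (simp add: B_def)
    finally have "(1 + B) * s \<le> B * s\<^sup>2" using s2_gt by (simp add: algebra_simps power2_eq_square)
    also have "\<dots> \<le> B * u" using u B_ge_1 by (intro mult_left_mono) auto
    finally have "(1 + B) / u \<le> B / s" using u s_gt_1 by (simp add: field_simps)
    then have "(1 + B) / u * (1 / u ^ n) \<le> B / s * (1 / u ^ n)"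
      using u by (intro mult_right_mono) auto
    then show ?thesis by (simp add: add_divide_distrib field_simps)
  qed
  ultimately show ?thesis
    using zero_weight_Suc_le[OF assms, of n] new_weight_le[OF assms, of n]
    unfolding branch_weight_def by (simp add: add_divide_distrib)
qed

lemma branch_weight_le:
  assumes "in_window u w" "m \<le> n"
  shows "branch_weight n u w \<le> branch_weight m u w / s ^ (n - m) + A * (w - u)"
  using assms(2)
proof (induction n rule: dec_induct)
  case base
  show ?case using A_pos in_windowD[OF assms(1)] by simp
next
  case (step n)
  have "branch_weight (Suc n) u w \<le> branch_weight n u w / s + (w - u) / (s\<^sup>2 - 1)"
    by (rule branch_weight_Suc_le[OF assms(1)])
  also have "\<dots> \<le> (branch_weight m u w / s ^ (n - m) + A * (w - u)) / s + (w - u) / (s\<^sup>2 - 1)"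
    using step s_gt_1 by (intro add_right_mono divide_right_mono) auto
  also have "\<dots> = branch_weight m u w / s ^ (Suc n - m) + (A / s + 1 / (s\<^sup>2 - 1)) * (w - u)"
    using step s_gt_1 by (simp add: Suc_diff_le field_simps)
  also have "A / s + 1 / (s\<^sup>2 - 1) = A"
    using s_gt_1 s2_gt by (simp add: A_def divide_simps)
  finally show ?case .
qed

text \<open>This is \<open>K + 1\<close> steps of \<open>zero_weight_Suc_le\<close>. All intermediate new weights are expressed by the last one,
because they can drop by at most a factor \<open>M\<close> per step.\<close>
lemma zero_weight_add_le:
  assumes "in_window u w" and mono: "\<And>n. new_weight n u w \<le> M * new_weight (Suc n) u w"
  shows "zero_weight (n + Suc K) u w
    \<le> zero_weight n u w / s\<^sup>2 ^ Suc K + Suc K * M ^ K * new_weight (n + K) u w + Suc K / u ^ n"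
proof (induction K)
  case 0
  have "1 / u ^ Suc n \<le> 1 / u ^ n" using in_windowD[OF assms(1)]
    by (intro divide_left_mono) auto
  then show ?case using zero_weight_Suc_le[OF assms(1), of n] by simp
next
  case (Suc K)
  note u = in_windowD[OF assms(1)]
  let ?G = "new_weight (n + Suc K) u w"
  have G: "0 \<le> ?G" using new_weight_nonneg[OF u(1)] .
  have "1 / u ^ Suc (n + Suc K) \<le> 1 / u ^ n" using u
    by (intro divide_left_mono power_increasing) auto
  moreover have "zero_weight (n + Suc K) u w / s\<^sup>2 \<le>
      zero_weight n u w / s\<^sup>2 ^ Suc (Suc K) + Suc K * M ^ Suc K * ?G + Suc K / u ^ n"
  proof -
    have "zero_weight (n + Suc K) u w / s\<^sup>2 \<le> (zero_weight n u w / s\<^sup>2 ^ Suc K) / s\<^sup>2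
        + (Suc K * M ^ K * new_weight (n + K) u w + Suc K / u ^ n) / s\<^sup>2"
      using divide_right_mono[OF Suc.IH, of "s\<^sup>2"] by (simp only: add_divide_distrib) simp
    also have "(Suc K * M ^ K * new_weight (n + K) u w + Suc K / u ^ n) / s\<^sup>2
        \<le> (Suc K * M ^ K * new_weight (n + K) u w + Suc K / u ^ n) / 1"
      using s2_gt u new_weight_nonneg[OF u(1)] by (intro divide_left_mono add_nonneg_nonneg) auto
    also have "Suc K * M ^ K * new_weight (n + K) u w \<le> Suc K * M ^ K * (M * ?G)"
      using mono[of "n + K"] u by (intro mult_left_mono) auto
    finally show ?thesis by (simp add: algebra_simps)
  qed
  moreover have "?G \<le> M ^ Suc K * ?G" using u G one_le_power[of M "Suc K"] mult_right_mono by fastforce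
  ultimately show ?case using zero_weight_Suc_le[OF assms(1), of "n + Suc K"]
    by (simp add: algebra_simps add_divide_distrib)
qed

section \<open>Measure of the set of parameters hitting a target\<close>

definition hits :: "nat \<Rightarrow> real \<Rightarrow> real \<Rightarrow> real \<Rightarrow> real \<Rightarrow> real set" where
  "hits n y r u w = {\<beta> \<in> {u<..<w}. \<bar>f n \<beta> - y\<bar> < r}"

lemma hits_borel [measurable]: "hits n y r u w \<in> sets borel"
  unfolding hits_def by measurable

lemma hits_fmeasurable: "hits n y r u w \<in> fmeasurable lborel"
  by (rule fmeasurableI2[of "{u<..<w}"]) (auto simp: hits_def[abs_def])

text \<open>This is the part of the branch containing \<open>p\<close> that lies to the right of \<open>p\<close>; \<open>p\<close> is either a zero or the
left end of the interval under consideration.\<close>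
definition branch :: "nat \<Rightarrow> real \<Rightarrow> real set" where
  "branch n p = {\<beta>. p \<le> \<beta> \<and> (\<forall>\<delta>. p < \<delta> \<and> \<delta> \<le> \<beta> \<longrightarrow> f n \<delta> \<noteq> 0)}"

lemma branches_cover:
  assumes "1 < u" "u < \<beta>" "\<beta> < w"
  shows "\<exists>p\<in>insert u (zeros n u w). \<beta> \<in> branch n p"
proof -
  let ?Y = "insert u {z \<in> zeros n u w. z \<le> \<beta>}"
  have fin: "finite ?Y" using finite_zeros[OF assms(1)] by simp
  define p where "p = Max ?Y"
  have p: "p \<in> ?Y" unfolding p_def using fin by (intro Max_in) auto
  have "f n \<delta> \<noteq> 0" if "p < \<delta>" "\<delta> \<le> \<beta>" for \<delta>
  proof
    assume "f n \<delta> = 0"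
    moreover have "u < \<delta>" using p that assms by (auto simp: zeros_def)
    ultimately have "\<delta> \<in> ?Y" using that assms by (auto simp: zeros_def)
    then have "\<delta> \<le> p" unfolding p_def using fin by (rule Max_ge[rotated])
    with that show False by simp
  qed
  with p assms have "\<beta> \<in> branch n p" by (auto simp: branch_def)
  with p show ?thesis by auto
qed

lemma branch_diff_le:
  assumes "1 < p" "\<beta> \<in> branch (Suc k) p" "\<gamma> \<in> branch (Suc k) p" "\<beta> \<le> \<gamma>"
  shows "x * p ^ k * (\<gamma> - \<beta>) \<le> f (Suc k) \<gamma> - f (Suc k) \<beta>"
proof -
  have "same_digits (Suc k) \<beta> \<gamma>"
    using assms by (intro same_digits_if_no_zero) (auto simp: branch_def)
  then have "x * \<beta> ^ k * (\<gamma> - \<beta>) \<le> f (Suc k) \<gamma> - f (Suc k) \<beta>"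
    using assms by (subst f_Suc_diff) (auto simp: same_digits_Suc branch_def intro!: lift_diff_lower)
  moreover have "x * p ^ k * (\<gamma> - \<beta>) \<le> x * \<beta> ^ k * (\<gamma> - \<beta>)"
    using assms x_pos by (intro mult_right_mono mult_left_mono power_mono) (auto simp: branch_def)
  ultimately show ?thesis by simp
qed

text \<open>Within one branch \<open>f n\<close> has slope at least \<open>x * p ^ (n - 1)\<close>, so the hits of a target of radius \<open>r\<close> lie in a
short interval. Its interior contains no zero of \<open>f n\<close>, so that at level \<open>n\<close> it has no weight apart from its
left end; this makes it a good starting point for the recursion on later levels.\<close>
lemma branch_hits_hull:
  assumes "in_window u w" "p \<in> insert u (zeros (Suc k) u w)" "0 \<le> r"
  obtains a b where "p \<le> a" "a \<le> b" "b \<le> w" "b - a \<le> 2 * M / x * r / p ^ Suc k"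
    "hits (Suc k) y r u w \<inter> branch (Suc k) p \<subseteq> {a..b}" "zeros (Suc k) a b = {}"
proof (cases "hits (Suc k) y r u w \<inter> branch (Suc k) p = {}")
  case True
  have "p \<le> w" "0 < p" using assms in_windowD[OF assms(1)] by (auto simp: zeros_def)
  show ?thesis
    by (rule that[of p p]) (use True x_pos assms \<open>p \<le> w\<close> \<open>0 < p\<close> in_windowD[OF assms(1)] in \<open>auto simp: zeros_def\<close>)
next
  case False
  let ?S = "hits (Suc k) y r u w \<inter> branch (Suc k) p"
  note u = in_windowD[OF assms(1)]
  have p: "1 < p" "p \<le> M" using assms(2) u by (auto simp: zeros_def)
  have diam: "\<gamma> - \<beta> \<le> 2 * M / x * r / p ^ Suc k" if "\<beta> \<in> ?S" "\<gamma> \<in> ?S" "\<beta> \<le> \<gamma>" for \<beta> \<gamma>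
  proof -
    have "\<bar>f (Suc k) \<gamma> - y\<bar> < r" "\<bar>f (Suc k) \<beta> - y\<bar> < r" using that by (auto simp: hits_def)
    then have "x * p ^ k * (\<gamma> - \<beta>) \<le> 2 * r"
      using branch_diff_le[OF p(1), of \<beta> k \<gamma>] that by auto
    then have "p * (x * p ^ k * (\<gamma> - \<beta>)) \<le> p * (2 * r)" using p by (intro mult_left_mono) auto
    also have "\<dots> \<le> M * (2 * r)" using p assms(3) by (intro mult_right_mono) auto
    finally show ?thesis using p x_pos by (simp add: field_simps)
  qed
  show ?thesis
  proof (rule hull_of_small_set[OF False])
    show "\<gamma> - \<beta> \<le> 2 * M / x * r / p ^ Suc k" if "\<beta> \<in> ?S" "\<gamma> \<in> ?S" "\<beta> \<le> \<gamma>" for \<beta> \<gamma>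
      using that by (rule diam)
  next
    fix a b
    assume ab: "?S \<subseteq> {a..b}" "a \<le> b" "b - a \<le> 2 * M / x * r / p ^ Suc k"
      and inner: "\<And>c. a < c \<Longrightarrow> c < b \<Longrightarrow> \<exists>\<beta>\<in>?S. \<exists>\<gamma>\<in>?S. \<beta> < c \<and> c < \<gamma>"
      and lower: "\<And>l. (\<And>\<beta>. \<beta> \<in> ?S \<Longrightarrow> l \<le> \<beta>) \<Longrightarrow> l \<le> a"
      and upper: "\<And>r. (\<And>\<beta>. \<beta> \<in> ?S \<Longrightarrow> \<beta> \<le> r) \<Longrightarrow> b \<le> r"
    have "p \<le> a" by (rule lower) (auto simp: branch_def)
    moreover have "b \<le> w" by (rule upper) (auto simp: hits_def)
    moreover have "zeros (Suc k) a b = {}"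
    proof (rule ccontr)
      assume "zeros (Suc k) a b \<noteq> {}"
      then obtain c where c: "a < c" "c < b" "f (Suc k) c = 0" by (auto simp: zeros_def)
      then obtain \<beta> \<gamma> where "\<beta> \<in> ?S" "\<gamma> \<in> ?S" "\<beta> < c" "c < \<gamma>" using inner by blast
      with c show False by (auto simp: branch_def)
    qed
    ultimately show ?thesis using ab by (intro that[of a b])
  qed
qed

lemma measure_hits_le:
  assumes "in_window u w" "0 \<le> r" "1 \<le> n"
  shows "measure lborel (hits n y r u w) \<le> 2 * M / x * r * (zero_weight n u w + 1 / u ^ n)"
proof -
  note u = in_windowD[OF assms(1)]
  obtain k where n: "n = Suc k" using assms(3) by (cases n) auto
  let ?P = "insert u (zeros n u w)"
  have fin: "finite ?P" using finite_zeros[OF u(1)] by simp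
  have "\<exists>a b. a \<le> b \<and> b - a \<le> 2 * M / x * r / p ^ n \<and>
      hits n y r u w \<inter> branch n p \<subseteq> {a..b}" if "p \<in> ?P" for p
    using branch_hits_hull[OF assms(1) _ assms(2), of p k y] that unfolding n by metis
  then obtain a b where ab: "\<And>p. p \<in> ?P \<Longrightarrow> a p \<le> b p \<and> b p - a p \<le> 2 * M / x * r / p ^ n \<and>
      hits n y r u w \<inter> branch n p \<subseteq> {a p..b p}" by metis
  have "hits n y r u w \<subseteq> (\<Union>p\<in>?P. {a p..b p})"
  proof
    fix \<beta> assume \<beta>: "\<beta> \<in> hits n y r u w"
    then have "u < \<beta>" "\<beta> < w" by (auto simp: hits_def)
    with branches_cover[OF u(1) this, of n] \<beta> ab show "\<beta> \<in> (\<Union>p\<in>?P. {a p..b p})" by blast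
  qed
  then have "measure lborel (hits n y r u w) \<le> measure lborel (\<Union>p\<in>?P. {a p..b p})"
    using fin by (intro measure_mono_fmeasurable fmeasurable.finite_UN) auto
  also have "\<dots> \<le> (\<Sum>p\<in>?P. measure lborel {a p..b p})"
    using fin by (intro measure_UNION_le) auto
  also have "\<dots> \<le> (\<Sum>p\<in>?P. 2 * M / x * r * (1 / p ^ n))"
    using ab by (intro sum_mono) force
  also have "\<dots> = 2 * M / x * r * (\<Sum>p\<in>?P. 1 / p ^ n)" by (simp only: sum_distrib_left)
  also have "(\<Sum>p\<in>?P. 1 / p ^ n) = zero_weight n u w + 1 / u ^ n"
    using fin by (subst sum.insert) (auto simp: zero_weight_def zeros_def)
  finally show ?thesis .
qed

text \<open>Each branch of level \<open>m\<close> meets the first target within a short interval \<open>[a, b]\<close>. Started at level \<open>m\<close> on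
\<open>[a, b]\<close>, the weight recursion gives weight at most \<open>B / (a ^ m * s ^ (n - m)) + A * (b - a)\<close> at level \<open>n\<close>.
The second summand produces the product \<open>r * r'\<close> of the radii, the first one the correlation error.\<close>
lemma measure_hits_Int_le:
  assumes in_window: "in_window u w" and r: "0 \<le> r" "0 \<le> r'" and mn: "1 \<le> m" "m \<le> n"
  shows "measure lborel (hits m y r u w \<inter> hits n y' r' u w)
    \<le> 2 * M / x * r' * (B / s ^ (n - m) + A * (2 * M / x) * r) * branch_weight m u w"
proof -
  note u = in_windowD[OF in_window]
  define C where "C = 2 * M / x"
  have C: "0 \<le> C" using u x_pos by (simp add: C_def)
  obtain k where m: "m = Suc k" using mn(1) by (cases m) auto
  let ?P = "insert u (zeros m u w)"
  have fin: "finite ?P" using finite_zeros[OF u(1)] by simp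
  have "\<exists>a b. p \<le> a \<and> a \<le> b \<and> b \<le> w \<and> b - a \<le> C * r / p ^ m \<and>
      hits m y r u w \<inter> branch m p \<subseteq> {a..b} \<and> zeros m a b = {}" if "p \<in> ?P" for p
    using branch_hits_hull[OF in_window _ r(1), of p k y] that unfolding m C_def by metis
  then obtain a b where ab: "\<And>p. p \<in> ?P \<Longrightarrow> p \<le> a p \<and> a p \<le> b p \<and> b p \<le> w \<and>
      b p - a p \<le> C * r / p ^ m \<and> hits m y r u w \<inter> branch m p \<subseteq> {a p..b p} \<and> zeros m (a p) (b p) = {}"
    by metis
  \<comment> \<open>The endpoints are added because the hull is closed, while \<open>hits\<close> refers to an open interval.\<close>
  let ?H = "\<lambda>p. hits n y' r' (a p) (b p) \<union> {a p, b p}"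
  have Hm: "measure lborel (?H p) = measure lborel (hits n y' r' (a p) (b p))" for p
    by (rule measure_Un_null_set) (auto simp: finite_imp_null_set_lborel)
  have "hits m y r u w \<inter> hits n y' r' u w \<subseteq> (\<Union>p\<in>?P. ?H p)"
  proof
    fix \<beta> assume \<beta>: "\<beta> \<in> hits m y r u w \<inter> hits n y' r' u w"
    then have "u < \<beta>" "\<beta> < w" by (auto simp: hits_def)
    then obtain p where p: "p \<in> ?P" "\<beta> \<in> branch m p" using branches_cover[OF u(1), of \<beta> w m] by blast
    then have "\<beta> \<in> {a p..b p}" using ab[OF p(1)] \<beta> by blast
    then have "\<beta> \<in> ?H p" using \<beta> by (auto simp: hits_def)
    then show "\<beta> \<in> (\<Union>p\<in>?P. ?H p)" using p by blast
  qed
  then have "measure lborel (hits m y r u w \<inter> hits n y' r' u w) \<le> measure lborel (\<Union>p\<in>?P. ?H p)"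
    using fin hits_fmeasurable by (intro measure_mono_fmeasurable fmeasurable.finite_UN fmeasurable.Un) auto
  also have "\<dots> \<le> (\<Sum>p\<in>?P. measure lborel (?H p))"
    using fin by (intro measure_UNION_le) auto
  also have "\<dots> \<le> (\<Sum>p\<in>?P. C * r' * (B / s ^ (n - m) + A * C * r) * (1 / p ^ m))"
  proof (rule sum_mono)
    fix p assume p: "p \<in> ?P"
    have "u \<le> p" using p by (auto simp: zeros_def)
    have in_window': "in_window (a p) (b p)" using ab[OF p] \<open>u \<le> p\<close> u by (auto simp: in_window_def)
    have "measure lborel (?H p) \<le> C * r' * (zero_weight n (a p) (b p) + 1 / a p ^ n)"
      unfolding Hm C_def using measure_hits_le[OF in_window' r(2)] mn by simp
    also have "\<dots> \<le> C * r' * branch_weight n (a p) (b p)"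
      using weight_le_branch_weight[OF in_window'] C r by (intro mult_left_mono) auto
    also have "\<dots> \<le> C * r' * (branch_weight m (a p) (b p) / s ^ (n - m) + A * (b p - a p))"
      using branch_weight_le[OF in_window' mn(2)] C r by (intro mult_left_mono) auto
    also have "branch_weight m (a p) (b p) = B / a p ^ m"
      using ab[OF p] by (simp add: branch_weight_def zero_weight_def)
    also have "C * r' * (B / a p ^ m / s ^ (n - m) + A * (b p - a p))
        \<le> C * r' * (B / p ^ m / s ^ (n - m) + A * (C * r / p ^ m))"
      using ab[OF p] C r \<open>u \<le> p\<close> u s_gt_1 A_pos B_ge_1
      by (intro mult_left_mono add_mono divide_right_mono divide_left_mono power_mono) auto
    also have "\<dots> = C * r' * (B / s ^ (n - m) + A * C * r) * (1 / p ^ m)"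
      by (simp add: field_simps add_divide_distrib)
    finally show "measure lborel (?H p) \<le> C * r' * (B / s ^ (n - m) + A * C * r) * (1 / p ^ m)" .
  qed
  also have "\<dots> = C * r' * (B / s ^ (n - m) + A * C * r) * (\<Sum>p\<in>?P. 1 / p ^ m)"
    by (simp only: sum_distrib_left)
  also have "(\<Sum>p\<in>?P. 1 / p ^ m) = zero_weight m u w + 1 / u ^ m"
    using fin by (subst sum.insert) (auto simp: zero_weight_def zeros_def)
  also have "C * r' * (B / s ^ (n - m) + A * C * r) * \<dots>
      \<le> C * r' * (B / s ^ (n - m) + A * C * r) * branch_weight m u w"
    using weight_le_branch_weight[OF in_window] C r A_pos B_ge_1 s_gt_1
    by (intro mult_left_mono mult_nonneg_nonneg add_nonneg_nonneg divide_nonneg_nonneg) auto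
  finally show ?thesis unfolding C_def .
qed

section \<open>Full branches fill a fixed proportion of every interval\<close>

text \<open>Every full branch of \<open>f (Suc n)\<close> contains a full branch of the next level, namely its initial part
with next digit 0: on the full branch \<open>\<beta> * f (Suc n) \<beta>\<close> increases from 0 to a limit above 1, and it takes
the value 1 at a new zero.\<close>
lemma new_weight_le_Suc:
  assumes "in_window u w"
  shows "new_weight n u w \<le> M * new_weight (Suc n) u w"
proof -
  note u = in_windowD[OF assms]
  have "\<exists>\<zeta>. left_zero n u w z < \<zeta> \<and> \<zeta> < z \<and> \<zeta> \<in> new_zeros (Suc n) u w"
    if z: "z \<in> new_zeros n u w" for z
  proof -
    define y where "y = left_zero n u w z"
    note y = left_zero[OF u(1) z, folded y_def]
    have "1 < y" using u y by simp
    obtain j :: int where j: "\<And>\<delta>. y \<le> \<delta> \<Longrightarrow> \<delta> \<le> z \<Longrightarrow> same_digits n y \<delta>"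
      "y * f n y = of_int j" "z * f n z = of_int j + 1"
      "\<And>\<delta>. y \<le> \<delta> \<Longrightarrow> \<delta> < z \<Longrightarrow> f (Suc n) \<delta> = \<delta> * f n \<delta> - of_int j"
      using new_zero_branch[of y z n] y \<open>1 < y\<close> by metis
    have "continuous_on {y..z} (\<lambda>\<delta>. \<delta> * (\<delta> * f n \<delta> - of_int j))"
      using j(1) by (intro continuous_intros continuous_on_f) auto
    then obtain \<zeta> where \<zeta>: "y \<le> \<zeta>" "\<zeta> \<le> z" "\<zeta> * (\<zeta> * f n \<zeta> - of_int j) = 1"
      using IVT'[of "\<lambda>\<delta>. \<delta> * (\<delta> * f n \<delta> - of_int j)" y 1 z] y \<open>1 < y\<close> j(2,3) by auto
    have "\<zeta> \<noteq> y" "\<zeta> \<noteq> z" using \<zeta>(3) j(2,3) \<open>1 < y\<close> y(2) by auto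
    with \<zeta> have lt: "y < \<zeta>" "\<zeta> < z" by auto
    with \<zeta>(3) j(4) have one: "\<zeta> * f (Suc n) \<zeta> = 1" by simp
    then have "f (Suc n) \<zeta> \<noteq> 0" "f (Suc (Suc n)) \<zeta> = 0"
      by (auto simp: param_orbit_Suc[of x "Suc n"])
    moreover have "f (Suc (Suc n)) y = 0" using y(4) by (rule zero_Suc)
    ultimately have "\<zeta> \<in> new_zeros (Suc n) u w"
      using lt y(1,3) by (force simp: new_zeros_def zeros_def)
    with lt show ?thesis unfolding y_def by blast
  qed
  then obtain \<zeta> where \<zeta>: "\<And>z. z \<in> new_zeros n u w \<Longrightarrow>
      left_zero n u w z < \<zeta> z \<and> \<zeta> z < z \<and> \<zeta> z \<in> new_zeros (Suc n) u w" by metis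
  have inj: "inj_on \<zeta> (new_zeros n u w)"
  proof (rule linorder_inj_onI)
    fix z z' assume z: "z < z'" "z \<in> new_zeros n u w" "z' \<in> new_zeros n u w"
    show "\<zeta> z \<noteq> \<zeta> z'"
      using left_zero_separates[OF u(1) z(2,3,1)] \<zeta>[OF z(2)] \<zeta>[OF z(3)] by auto
  qed auto
  have pos: "1 < z" if "z \<in> new_zeros k u w" for z k using that u by (auto simp: new_zeros_def zeros_def)
  have "new_weight n u w \<le> (\<Sum>z\<in>new_zeros n u w. M * (1 / \<zeta> z ^ Suc (Suc n)))"
    unfolding new_weight_def
  proof (rule sum_mono)
    fix z assume z: "z \<in> new_zeros n u w"
    have z1: "1 < \<zeta> z" "1 < z" "z \<le> M" using pos z \<zeta>[OF z] u by (auto simp: new_zeros_def zeros_def)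
    have "1 / z ^ Suc n = z * (1 / z ^ Suc (Suc n))" using z1 by simp
    also have "\<dots> \<le> M * (1 / \<zeta> z ^ Suc (Suc n))"
      using z1 \<zeta>[OF z] by (intro mult_mono divide_left_mono power_mono mult_pos_pos zero_less_power) auto
    finally show "1 / z ^ Suc n \<le> M * (1 / \<zeta> z ^ Suc (Suc n))" .
  qed
  also have "\<dots> = M * (\<Sum>z\<in>\<zeta> ` new_zeros n u w. 1 / z ^ Suc (Suc n))"
    by (simp only: sum.reindex[OF inj] sum_distrib_left comp_def)
  also have "\<dots> \<le> M * new_weight (Suc n) u w"
    unfolding new_weight_def using u finite_new_zeros[OF u(1)] \<zeta>
    by (intro mult_left_mono sum_mono2) (auto dest: pos simp del: power_Suc)
  finally show ?thesis .
qed

text \<open>The branches cover the interval, and the one starting at \<open>p\<close> has length \<open>O(1 / p ^ n)\<close>.\<close>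
lemma zero_weight_lower:
  assumes "in_window u w" "1 \<le> n"
  shows "x / (2 * M) * (w - u) - 1 / u ^ n \<le> zero_weight n u w"
proof -
  note u = in_windowD[OF assms(1)]
  \<comment> \<open>The target of radius 1 around \<open>1/2\<close> contains \<open>[0,1]\<close>, so every parameter hits it.\<close>
  have "hits n (1/2) 1 u w = {u<..<w}"
  proof -
    have "\<bar>f n \<beta> - 1/2\<bar> < 1" for \<beta> using f_nonneg[of n \<beta>] f_le_1[of n \<beta>] by (simp add: abs_less_iff)
    then show ?thesis by (auto simp: hits_def)
  qed
  then have "w - u \<le> 2 * M / x * (zero_weight n u w + 1 / u ^ n)"
    using measure_hits_le[OF assms(1) _ assms(2), of 1 "1/2"] u by simp
  then have "x / (2 * M) * (w - u) \<le> x / (2 * M) * (2 * M / x * (zero_weight n u w + 1 / u ^ n))"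
    using x_pos u by (intro mult_left_mono) auto
  also have "\<dots> = zero_weight n u w + 1 / u ^ n" using x_pos u by simp
  finally show ?thesis by simp
qed

lemma branch_weight_le_window: "in_window u w \<Longrightarrow> branch_weight n u w \<le> B / s ^ n + A * (w - u)"
  using branch_weight_le[of u w 0 n] by (simp add: branch_weight_def zero_weight_def)

lemma decay:
  assumes "0 < (e :: real)"
  obtains N where "\<And>n. N \<le> n \<Longrightarrow> C / s ^ n \<le> e"
proof -
  have "(\<lambda>n. C * (1 / s) ^ n) \<longlonglongrightarrow> C * 0"
    using s_gt_1 by (intro tendsto_mult_left LIMSEQ_realpow_zero) auto
  then have "eventually (\<lambda>n. C * (1 / s) ^ n < e) sequentially"
    using assms by (intro order_tendstoD(2)) auto
  then obtain N where "\<And>n. N \<le> n \<Longrightarrow> C / s ^ n < e"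
    by (auto simp: eventually_sequentially power_one_over)
  then show ?thesis by (intro that[of N] less_imp_le)
qed

text \<open>By \<open>zero_weight_lower\<close> the weight at level \<open>n + K + 1\<close> is at least a constant times \<open>w - u\<close>. By
\<open>zero_weight_add_le\<close> it consists of the new weight, the weight at level \<open>n\<close> damped by \<open>(s\<^sup>2) ^ (K + 1)\<close>, and an
exponentially small error. The weight at level \<open>n\<close> is \<open>O(w - u)\<close>, so for a suitable fixed \<open>K\<close> only the new
weight can supply the main part. The constant \<open>c\<close> does not depend on the interval, the threshold \<open>N\<close> does.\<close>
lemma new_weight_lower:
  obtains c where "0 < c" "\<And>u w. in_window u w \<Longrightarrow> u < w \<Longrightarrow> \<exists>N. \<forall>n\<ge>N. c * (w - u) \<le> new_weight n u w"
proof -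
  define \<kappa> where "\<kappa> = x / (2 * M)"
  have \<kappa>: "0 < \<kappa>" using x_pos M_gt_1 by (simp add: \<kappa>_def)
  obtain K where K: "A / s ^ K \<le> \<kappa> / 4" using decay[of "\<kappa> / 4" A] \<kappa> by auto
  have K2: "A / (s\<^sup>2) ^ Suc K \<le> \<kappa> / 4"
  proof -
    have "s ^ K \<le> (s\<^sup>2) ^ K" using s_gt_1 s2_gt by (intro power_mono) auto
    also have "\<dots> \<le> (s\<^sup>2) ^ Suc K" using s2_gt by (intro power_increasing) auto
    finally have "A / (s\<^sup>2) ^ Suc K \<le> A / s ^ K"
      using s_gt_1 A_pos by (intro divide_left_mono mult_pos_pos) auto
    also note K
    finally show ?thesis .
  qed
  define D where "D = Suc K * M ^ K"
  have D: "0 < D" using M_gt_1 by (simp add: D_def)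
  show ?thesis
  proof (rule that[of "\<kappa> / (2 * D)"])
    show "0 < \<kappa> / (2 * D)" using \<kappa> D by simp
    fix u w assume in_window: "in_window u w" and uw: "u < w"
    note u = in_windowD[OF in_window]
    have "0 < \<kappa> / 4 * (w - u)" using \<kappa> uw by simp
    then obtain N where N: "\<And>n. N \<le> n \<Longrightarrow> (B + Suc K + 1) / s ^ n \<le> \<kappa> / 4 * (w - u)"
      using decay by blast
    have "\<kappa> / (2 * D) * (w - u) \<le> new_weight n u w" if n: "N + K \<le> n" for n
    proof -
      define k where "k = n - K"
      have k: "n = k + K" "N \<le> k" using n by (auto simp: k_def)
      have su: "1 / u ^ m \<le> 1 / s ^ k" if "k \<le> m" for m
      proof -
        have "s ^ k \<le> u ^ k" using s_gt_1 s2_gt u by (intro power_mono) auto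
        also have "\<dots> \<le> u ^ m" using that u by (intro power_increasing) auto
        finally show ?thesis using s_gt_1 u by (intro divide_left_mono mult_pos_pos) auto
      qed
      have "\<kappa> * (w - u) - 1 / s ^ k \<le> zero_weight (k + Suc K) u w"
        using zero_weight_lower[OF in_window, of "k + Suc K"] su[of "k + Suc K"] unfolding \<kappa>_def by simp
      also have "\<dots> \<le> zero_weight k u w / s\<^sup>2 ^ Suc K + D * new_weight n u w + Suc K / u ^ k"
        using zero_weight_add_le[OF in_window new_weight_le_Suc[OF in_window], of k K] unfolding D_def k(1) .
      also have "Suc K / u ^ k \<le> Suc K / s ^ k" using mult_left_mono[OF su[of k], of "Suc K"] by simp
      also have "zero_weight k u w / s\<^sup>2 ^ Suc K \<le> (B / s ^ k + A * (w - u)) / s\<^sup>2 ^ Suc K"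
      proof (rule divide_right_mono)
        have "0 \<le> 1 / u ^ k" using u by simp
        then show "zero_weight k u w \<le> B / s ^ k + A * (w - u)"
          using weight_le_branch_weight[OF in_window, of k] branch_weight_le_window[OF in_window, of k] by linarith
      qed (use s2_gt in auto)
      also have "\<dots> = B / s ^ k / s\<^sup>2 ^ Suc K + A / s\<^sup>2 ^ Suc K * (w - u)"
        by (simp add: add_divide_distrib)
      also have "\<dots> \<le> B / s ^ k / 1 + \<kappa> / 4 * (w - u)"
        using K2 uw B_ge_1 s_gt_1 s2_gt one_le_power[of "s\<^sup>2" "Suc K"]
        by (intro add_mono divide_left_mono mult_right_mono) auto
      finally have "\<kappa> * (w - u) - 1 / s ^ k
          \<le> B / s ^ k / 1 + \<kappa> / 4 * (w - u) + D * new_weight n u w + Suc K / s ^ k" by simp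
      then have "\<kappa> * (w - u) \<le> (B + Suc K + 1) / s ^ k + \<kappa> / 4 * (w - u) + D * new_weight n u w"
        by (simp add: add_divide_distrib)
      also have "(B + Suc K + 1) / s ^ k \<le> \<kappa> / 4 * (w - u)" using N[OF k(2)] .
      finally have "\<kappa> / 2 * (w - u) \<le> D * new_weight n u w" by simp
      then show ?thesis using D by (simp add: field_simps)
    qed
    then show "\<exists>N. \<forall>n\<ge>N. \<kappa> / (2 * D) * (w - u) \<le> new_weight n u w" by blast
  qed
qed

text \<open>On each full branch \<open>f (Suc n)\<close> takes every value in \<open>[0,1)\<close>, in particular those of an interval of length
\<open>r / 4\<close> close to \<open>y\<close>, and its slope is \<open>O(z ^ Suc n)\<close>.\<close>
lemma measure_hits_ge:
  assumes in_window: "in_window u w" and y: "0 \<le> y" "y \<le> 1" and r: "0 < r" "r \<le> 1"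
  shows "(s\<^sup>2 - 1) / 4 * r * new_weight n u w \<le> measure lborel (hits (Suc n) y r u w)"
proof -
  note u = in_windowD[OF in_window]
  let ?S = "hits (Suc n) y r u w"
  have "(\<Sum>z\<in>new_zeros n u w. (s\<^sup>2 - 1) / 4 * r * (1 / z ^ Suc n)) \<le> measure lborel ?S"
  proof (rule measure_new_branches[OF u(1,3)])
    show "?S \<subseteq> {u<..<w}" by (auto simp: hits_def)
    fix z assume z: "z \<in> new_zeros n u w"
    define l where "l = left_zero n u w z"
    note l = left_zero[OF u(1) z, folded l_def]
    have "1 < l" using u l by simp
    obtain j :: int where j: "\<And>\<delta>. l \<le> \<delta> \<Longrightarrow> \<delta> \<le> z \<Longrightarrow> same_digits n l \<delta>"
      "l * f n l = of_int j" "z * f n z = of_int j + 1"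
      "\<And>\<delta>. l \<le> \<delta> \<Longrightarrow> \<delta> < z \<Longrightarrow> f (Suc n) \<delta> = \<delta> * f n \<delta> - of_int j"
      using new_zero_branch[of l z n] l \<open>1 < l\<close> by metis
    \<comment> \<open>The values \<open>[a, a + r / 4]\<close> lie within \<open>r\<close> of \<open>y\<close> and inside \<open>[0,1]\<close>, wherever \<open>y\<close> lies in \<open>[0,1]\<close>.\<close>
    define a where "a = max 0 (y - r / 2)"
    have a: "0 \<le> a" "y - r / 2 \<le> a" "a + r / 4 \<le> 1" "a + r / 4 < y + r"
      using y r by (auto simp: a_def)
    have cont: "continuous_on {l'..z} (\<lambda>\<delta>. \<delta> * f n \<delta>)" if "l \<le> l'" for l'
      using j(1) that by (intro continuous_intros continuous_on_f[where \<beta> = l]) auto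
    obtain \<beta> where \<beta>: "l \<le> \<beta>" "\<beta> \<le> z" "\<beta> * f n \<beta> = of_int j + a"
      using IVT'[of "\<lambda>\<delta>. \<delta> * f n \<delta>" l "of_int j + a" z] cont[of l] j(2,3) a r l by auto
    obtain \<gamma> where \<gamma>: "\<beta> \<le> \<gamma>" "\<gamma> \<le> z" "\<gamma> * f n \<gamma> = of_int j + (a + r / 4)"
      using IVT'[of "\<lambda>\<delta>. \<delta> * f n \<delta>" \<beta> "of_int j + (a + r / 4)" z] cont[of \<beta>] j(3) \<beta> a r by auto
    have dig: "same_digits n \<delta> \<eta>" if "l \<le> \<delta>" "\<delta> \<le> z" "l \<le> \<eta>" "\<eta> \<le> z" for \<delta> \<eta>
      using same_digits_trans j(1) that by blast
    have "r / 4 = \<gamma> * f n \<gamma> - \<beta> * f n \<beta>" using \<beta> \<gamma> by simp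
    also have "\<dots> \<le> (\<gamma> - \<beta>) * (\<gamma> ^ Suc n / (\<gamma> - 1))"
      using \<beta> \<gamma> \<open>1 < l\<close> dig by (intro lift_diff_upper) auto
    also have "\<dots> \<le> (\<gamma> - \<beta>) * (z ^ Suc n / (s\<^sup>2 - 1))"
      using \<beta> \<gamma> \<open>1 < l\<close> u l s2_gt
      by (intro mult_left_mono frac_le power_mono) auto
    finally have len: "(s\<^sup>2 - 1) / 4 * r * (1 / z ^ Suc n) \<le> \<gamma> - \<beta>"
      using l \<open>1 < l\<close> s2_gt by (simp add: field_simps)
    have "{\<beta><..<\<gamma>} \<subseteq> ?S \<inter> {l<..<z}"
    proof
      fix \<delta> assume \<delta>: "\<delta> \<in> {\<beta><..<\<gamma>}"
      have "\<beta> * f n \<beta> < \<delta> * f n \<delta>" "\<delta> * f n \<delta> < \<gamma> * f n \<gamma>"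
        using \<delta> \<beta> \<gamma> \<open>1 < l\<close> dig[of \<beta> \<delta>] dig[of \<delta> \<gamma>]
          lift_strict_mono[of \<beta> \<delta> n] lift_strict_mono[of \<delta> \<gamma> n] by auto
      moreover have "f (Suc n) \<delta> = \<delta> * f n \<delta> - of_int j" using \<delta> \<beta> \<gamma> by (intro j(4)) auto
      ultimately have "\<bar>f (Suc n) \<delta> - y\<bar> < r" using \<beta>(3) \<gamma>(3) a r by (auto simp: abs_less_iff)
      then show "\<delta> \<in> ?S \<inter> {l<..<z}" using \<delta> \<beta> \<gamma> l by (auto simp: hits_def)
    qed
    moreover have "?S \<inter> {l<..<z} \<in> fmeasurable lborel"
      by (rule fmeasurableI2[OF hits_fmeasurable]) auto
    ultimately have "measure lborel {\<beta><..<\<gamma>} \<le> measure lborel (?S \<inter> {l<..<z})"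
      by (intro measure_mono_fmeasurable) auto
    then show "(s\<^sup>2 - 1) / 4 * r * (1 / z ^ Suc n) \<le> measure lborel (?S \<inter> {left_zero n u w z<..<z})"
      using len \<gamma> by (simp add: l_def)
  qed simp
  also have "(\<Sum>z\<in>new_zeros n u w. (s\<^sup>2 - 1) / 4 * r * (1 / z ^ Suc n))
      = (s\<^sup>2 - 1) / 4 * r * new_weight n u w"
    unfolding new_weight_def by (simp only: sum_distrib_left)
  finally show ?thesis .
qed

end

section \<open>The second moment method\<close>

text \<open>With \<open>g\<close> the number of sets that contain a given point, \<open>2 * t * g - t\<^sup>2 * g\<^sup>2\<close> is at most 1, because
\<open>(1 - t * g)\<^sup>2\<close> is nonnegative, and it vanishes off the union. Integrating gives the bound.\<close>
lemma measure_Union_ge_second_moment: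
  fixes t :: real
  assumes fin: "finite I" and E: "\<And>i. i \<in> I \<Longrightarrow> E i \<in> fmeasurable M"
  shows "2 * t * (\<Sum>i\<in>I. measure M (E i)) - t\<^sup>2 * (\<Sum>i\<in>I. \<Sum>j\<in>I. measure M (E i \<inter> E j))
    \<le> measure M (\<Union>i\<in>I. E i)"
proof -
  let ?U = "\<Union>i\<in>I. E i"
  let ?f = "\<lambda>\<omega>. \<Sum>i\<in>I. indicator (E i) \<omega> :: real"
  let ?g = "\<lambda>\<omega>. \<Sum>i\<in>I. \<Sum>j\<in>I. indicator (E i \<inter> E j) \<omega> :: real"
  have U: "?U \<in> fmeasurable M" using fin E by (rule fmeasurable.finite_UN)
  have int: "integrable M (indicator A :: _ \<Rightarrow> real)" "(\<integral>\<omega>. indicator A \<omega> \<partial>M) = measure M A"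
    if "A \<in> fmeasurable M" for A
    using that by (auto simp: fmeasurable_def)
  have E2: "E i \<inter> E j \<in> fmeasurable M" if "i \<in> I" "j \<in> I" for i j
    using E that by (intro fmeasurable.Int)
  have "(\<integral>\<omega>. 2 * t * ?f \<omega> - t\<^sup>2 * ?g \<omega> \<partial>M) \<le> (\<integral>\<omega>. indicator ?U \<omega> \<partial>M)"
  proof (rule integral_mono)
    show "integrable M (\<lambda>\<omega>. 2 * t * ?f \<omega> - t\<^sup>2 * ?g \<omega>)"
      using int E E2 by (intro Bochner_Integration.integrable_diff integrable_mult_right
          Bochner_Integration.integrable_sum) auto
    show "integrable M (indicator ?U :: _ \<Rightarrow> real)" using int U by blast
    fix \<omega>
    have g: "?g \<omega> = (?f \<omega>)\<^sup>2"
      by (simp add: power2_eq_square sum_product indicator_inter_arith)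
    show "2 * t * ?f \<omega> - t\<^sup>2 * ?g \<omega> \<le> indicator ?U \<omega>"
    proof (cases "\<omega> \<in> ?U")
      case True
      have "0 \<le> (1 - t * ?f \<omega>)\<^sup>2" by simp
      then show ?thesis using True unfolding g by (simp add: power2_eq_square algebra_simps)
    next
      case False
      then have "?f \<omega> = 0" by (intro sum.neutral) auto
      then show ?thesis unfolding g by simp
    qed
  qed
  also have "(\<integral>\<omega>. 2 * t * ?f \<omega> - t\<^sup>2 * ?g \<omega> \<partial>M)
      = 2 * t * (\<Sum>i\<in>I. measure M (E i)) - t\<^sup>2 * (\<Sum>i\<in>I. \<Sum>j\<in>I. measure M (E i \<inter> E j))"
    using int E E2 by (subst Bochner_Integration.integral_diff)
      (auto simp: Bochner_Integration.integral_sum intro!: Bochner_Integration.integrable_sum sum.cong)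
  finally show ?thesis using int U by simp
qed

text \<open>The correlation errors \<open>q ^ (j - i)\<close> sum to \<open>O(S)\<close>, where \<open>S\<close> is the sum of the \<open>\<phi> i\<close>. As \<open>S \<ge> 1\<close>, the
second moment is \<open>O(L * S\<^sup>2)\<close>, and the optimal \<open>t\<close> in \<open>measure_Union_ge_second_moment\<close> is of order \<open>1 / S\<close>.\<close>
lemma measure_Union_ge_quasi_independent:
  fixes \<phi> :: "nat \<Rightarrow> real"
  assumes fin: "finite I" and E: "\<And>i. i \<in> I \<Longrightarrow> E i \<in> fmeasurable M"
    and pos: "0 < c" "0 < D" "0 \<le> L" "0 < q" "q < 1" "\<And>i. i \<in> I \<Longrightarrow> 0 \<le> \<phi> i"
    and lower: "\<And>i. i \<in> I \<Longrightarrow> c * L * \<phi> i \<le> measure M (E i)"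
    and upper: "\<And>i j. i \<in> I \<Longrightarrow> j \<in> I \<Longrightarrow> i \<le> j \<Longrightarrow>
      measure M (E i \<inter> E j) \<le> D * L * (\<phi> i * \<phi> j + \<phi> j * q ^ (j - i))"
    and large: "1 \<le> (\<Sum>i\<in>I. \<phi> i)"
  shows "c\<^sup>2 / (D * (1 + 2 / (1 - q))) * L \<le> measure M (\<Union>i\<in>I. E i)"
proof -
  define S where "S = (\<Sum>i\<in>I. \<phi> i)"
  define D' where "D' = D * (1 + 2 / (1 - q))"
  have D': "0 < D'" using pos by (simp add: D'_def add_pos_pos)
  define \<rho> where "\<rho> i j = (if i \<le> j then q ^ (j - i) else 0)" for i j
  have geo: "(\<Sum>i\<in>I. \<rho> i j) \<le> 1 / (1 - q)" for j
  proof -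
    have "(\<Sum>i\<in>I. \<rho> i j) = (\<Sum>i\<in>{i\<in>I. i \<le> j}. q ^ (j - i))"
      unfolding \<rho>_def using fin by (simp add: sum.inter_filter)
    also have "\<dots> = (\<Sum>k\<in>(\<lambda>i. j - i) ` {i\<in>I. i \<le> j}. q ^ k)"
      by (subst sum.reindex) (auto simp: inj_on_def)
    also have "\<dots> \<le> (\<Sum>k. q ^ k)"
      using pos fin by (intro sum_le_suminf) (auto intro!: summable_geometric)
    also have "\<dots> = 1 / (1 - q)" using pos by (intro suminf_geometric) auto
    finally show ?thesis .
  qed
  have pair: "measure M (E i \<inter> E j) \<le> D * L * (\<phi> i * \<phi> j + \<phi> j * \<rho> i j + \<phi> i * \<rho> j i)"
    if ij: "i \<in> I" "j \<in> I" for i j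
  proof (cases "i \<le> j")
    case True
    have "measure M (E i \<inter> E j) \<le> D * L * (\<phi> i * \<phi> j + \<phi> j * \<rho> i j)"
      using upper[OF ij True] True by (simp add: \<rho>_def)
    also have "\<dots> \<le> D * L * (\<phi> i * \<phi> j + \<phi> j * \<rho> i j + \<phi> i * \<rho> j i)"
      using pos ij by (intro mult_left_mono) (auto simp: \<rho>_def)
    finally show ?thesis .
  next
    case False
    have "measure M (E i \<inter> E j) \<le> D * L * (\<phi> i * \<phi> j + \<phi> i * \<rho> j i)"
      using upper[OF ij(2,1)] False by (simp add: \<rho>_def Int_commute mult.commute)
    also have "\<dots> \<le> D * L * (\<phi> i * \<phi> j + \<phi> j * \<rho> i j + \<phi> i * \<rho> j i)"
      using pos ij by (intro mult_left_mono) (auto simp: \<rho>_def)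
    finally show ?thesis .
  qed
  have S1: "1 \<le> S" using large by (simp add: S_def)
  have cross: "(\<Sum>i\<in>I. \<Sum>j\<in>I. \<phi> i * \<rho> j i) \<le> S / (1 - q)"
  proof -
    have "(\<Sum>i\<in>I. \<Sum>j\<in>I. \<phi> i * \<rho> j i) = (\<Sum>i\<in>I. \<phi> i * (\<Sum>j\<in>I. \<rho> j i))"
      by (simp add: sum_distrib_left)
    also have "\<dots> \<le> (\<Sum>i\<in>I. \<phi> i * (1 / (1 - q)))"
      using geo pos by (intro sum_mono mult_left_mono) auto
    also have "\<dots> = S / (1 - q)" by (simp add: S_def sum_divide_distrib)
    finally show ?thesis .
  qed
  have "(\<Sum>i\<in>I. \<Sum>j\<in>I. measure M (E i \<inter> E j))
      \<le> (\<Sum>i\<in>I. \<Sum>j\<in>I. D * L * (\<phi> i * \<phi> j + \<phi> j * \<rho> i j + \<phi> i * \<rho> j i))"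
    using pair by (intro sum_mono) auto
  also have "\<dots> = D * L * ((\<Sum>i\<in>I. \<Sum>j\<in>I. \<phi> i * \<phi> j) + (\<Sum>i\<in>I. \<Sum>j\<in>I. \<phi> j * \<rho> i j)
      + (\<Sum>i\<in>I. \<Sum>j\<in>I. \<phi> i * \<rho> j i))"
    by (simp only: sum_distrib_left[symmetric] sum.distrib)
  also have "(\<Sum>i\<in>I. \<Sum>j\<in>I. \<phi> i * \<phi> j) = S\<^sup>2"
    by (simp add: S_def power2_eq_square sum_product)
  also have "(\<Sum>i\<in>I. \<Sum>j\<in>I. \<phi> j * \<rho> i j) = (\<Sum>i\<in>I. \<Sum>j\<in>I. \<phi> i * \<rho> j i)"
    by (rule sum.swap)
  also have "D * L * (S\<^sup>2 + (\<Sum>i\<in>I. \<Sum>j\<in>I. \<phi> i * \<rho> j i) + (\<Sum>i\<in>I. \<Sum>j\<in>I. \<phi> i * \<rho> j i))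
      \<le> D * L * (S\<^sup>2 + S\<^sup>2 / (1 - q) + S\<^sup>2 / (1 - q))"
  proof -
    have "S / (1 - q) \<le> S\<^sup>2 / (1 - q)"
      using S1 pos by (intro divide_right_mono) (auto simp: power2_eq_square)
    then show ?thesis using cross pos by (intro mult_left_mono add_mono) auto
  qed
  also have "\<dots> = D' * L * S\<^sup>2" by (simp add: D'_def field_simps)
  finally have second: "(\<Sum>i\<in>I. \<Sum>j\<in>I. measure M (E i \<inter> E j)) \<le> D' * L * S\<^sup>2" .
  have first: "c * L * S \<le> (\<Sum>i\<in>I. measure M (E i))"
    using lower by (simp add: S_def sum_distrib_left sum_mono)
  define t where "t = c / (D' * S)"
  have t: "0 \<le> t" using pos D' S1 by (simp add: t_def)
  have "c\<^sup>2 / D' * L = 2 * t * (c * L * S) - t\<^sup>2 * (D' * L * S\<^sup>2)"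
    using D' S1 by (simp add: t_def field_simps power2_eq_square)
  also have "\<dots> \<le> 2 * t * (\<Sum>i\<in>I. measure M (E i)) - t\<^sup>2 * (\<Sum>i\<in>I. \<Sum>j\<in>I. measure M (E i \<inter> E j))"
    using first second t by (intro diff_mono mult_left_mono) auto
  also have "\<dots> \<le> measure M (\<Union>i\<in>I. E i)"
    using fin E by (rule measure_Union_ge_second_moment)
  finally show ?thesis by (simp add: D'_def)
qed

section \<open>Passing to almost every parameter\<close>

text \<open>Cover the complement of \<open>E\<close> by an open set \<open>U\<close> that exceeds it by measure less than \<open>e\<close>. The components of
\<open>U\<close> are intervals, so \<open>E\<close> occupies at least the proportion \<open>\<delta>\<close> of each of them and hence of \<open>U\<close>. But the part of \<open>E\<close>
in \<open>U\<close> has measure below \<open>e\<close>, so \<open>U\<close> has measure at most \<open>e / \<delta>\<close>.\<close>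
lemma null_set_if_dense_on_intervals:
  fixes E :: "real set"
  assumes E: "E \<in> sets borel" and \<delta>: "0 < \<delta>"
    and dense: "\<And>u w. a \<le> u \<Longrightarrow> u < w \<Longrightarrow> w \<le> b \<Longrightarrow> \<delta> * (w - u) \<le> measure lborel (E \<inter> {u<..<w})"
  shows "{a<..<b} - E \<in> null_sets lborel"
proof -
  let ?N = "{a<..<b} - E"
  have N: "?N \<in> sets borel" using E by auto
  have small: "emeasure lborel ?N \<le> ennreal (e / \<delta>)" if e: "0 < e" for e :: real
  proof -
    obtain U0 where U0: "open U0" "?N \<subseteq> U0" "emeasure lborel (U0 - ?N) < e"
      using outer_regular_lborel[OF N e] by blast
    define U where "U = U0 \<inter> {a<..<b}"
    have U: "open U" "?N \<subseteq> U" using U0 by (auto simp: U_def)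
    have comp: "emeasure lborel C \<le> ennreal (1 / \<delta>) * emeasure lborel (E \<inter> C)"
      and comp_borel: "C \<in> sets borel" if C: "C \<in> components U" for C
    proof -
      have "open C" using open_components[OF U(1) C] .
      then show "C \<in> sets borel" by simp
      have ne: "C \<noteq> {}" using in_components_nonempty[OF C] .
      have sub: "C \<subseteq> {a<..<b}" using in_components_subset[OF C] by (auto simp: U_def)
      have iv: "is_interval C"
        using in_components_connected[OF C] by (simp add: is_interval_connected_1)
      have bdd: "bdd_above C" "bdd_below C"
        using sub by (auto intro: bdd_above_mono bdd_below_mono)
      define u where "u = Inf C"
      define w where "w = Sup C"
      have "a \<le> u" unfolding u_def using sub by (intro cInf_greatest[OF ne]) auto
      have "w \<le> b" unfolding w_def using sub by (intro cSup_least[OF ne]) auto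
      have "{u<..<w} \<subseteq> C"
      proof
        fix c assume "c \<in> {u<..<w}"
        then obtain c1 c2 where "c1 \<in> C" "c1 < c" "c2 \<in> C" "c < c2"
          using ne bdd by (auto simp: u_def w_def cInf_less_iff less_cSup_iff)
        then show "c \<in> C" using iv unfolding is_interval_1 by (meson less_imp_le)
      qed
      moreover have "C \<subseteq> {u..w}" using bdd by (auto simp: u_def w_def intro: cInf_lower cSup_upper)
      ultimately have le: "emeasure lborel C \<le> emeasure lborel {u..w}"
        "emeasure lborel (E \<inter> {u<..<w}) \<le> emeasure lborel (E \<inter> C)"
        using E \<open>open C\<close> by (auto intro!: emeasure_mono)
      show "emeasure lborel C \<le> ennreal (1 / \<delta>) * emeasure lborel (E \<inter> C)"
      proof (cases "u < w")
        case True
        have fm: "E \<inter> {u<..<w} \<in> fmeasurable lborel"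
          by (rule fmeasurableI2[of "{u<..<w}"]) (use E in auto)
        have "w - u \<le> 1 / \<delta> * measure lborel (E \<inter> {u<..<w})"
          using dense[OF \<open>a \<le> u\<close> True \<open>w \<le> b\<close>] \<delta> by (simp add: field_simps)
        then have "ennreal (w - u) \<le> ennreal (1 / \<delta>) * emeasure lborel (E \<inter> {u<..<w})"
          using \<delta> by (simp add: emeasure_eq_measure2[OF fm] ennreal_mult[symmetric] ennreal_leI)
        also have "\<dots> \<le> ennreal (1 / \<delta>) * emeasure lborel (E \<inter> C)"
          using le(2) by (rule mult_left_mono) simp
        finally show ?thesis using le(1) True by simp
      next
        case False
        then have "emeasure lborel C = 0"
          using le(1) by (auto simp: emeasure_lborel_Icc_eq split: if_splits)
        then show ?thesis by simp
      qed
    qed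
    have disj: "disjoint_family_on (\<lambda>C. C) (components U)" "disjoint_family_on (\<lambda>C. E \<inter> C) (components U)"
      using pairwise_disjoint_components[of U]
      by (auto simp: disjoint_family_on_def pairwise_def)
    have count: "countable (components U)"
      using U(1) pairwise_disjoint_components[of U]
      by (intro countable_disjoint_open_subsets) (auto simp: open_components disjnt_def pairwise_def)
    have "emeasure lborel ?N \<le> emeasure lborel (\<Union>C\<in>components U. C)"
      using U by (intro emeasure_mono) auto
    also have "\<dots> = (\<integral>\<^sup>+C. emeasure lborel C \<partial>count_space (components U))"
      using comp_borel count disj by (intro emeasure_UN_countable) auto
    also have "\<dots> \<le> (\<integral>\<^sup>+C. ennreal (1 / \<delta>) * emeasure lborel (E \<inter> C) \<partial>count_space (components U))"
      using comp by (intro nn_integral_mono) auto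
    also have "\<dots> = ennreal (1 / \<delta>) * (\<integral>\<^sup>+C. emeasure lborel (E \<inter> C) \<partial>count_space (components U))"
      by (intro nn_integral_cmult) auto
    also have "(\<integral>\<^sup>+C. emeasure lborel (E \<inter> C) \<partial>count_space (components U))
        = emeasure lborel (\<Union>C\<in>components U. E \<inter> C)"
      using comp_borel count disj E by (intro emeasure_UN_countable[symmetric]) auto
    also have "(\<Union>C\<in>components U. E \<inter> C) = E \<inter> U" by (auto simp: Union_components)
    also have "emeasure lborel (E \<inter> U) \<le> emeasure lborel (U0 - ?N)"
      using U0 N E by (intro emeasure_mono) (auto simp: U_def)
    also have "\<dots> \<le> ennreal e" using U0 by simp
    also have "ennreal (1 / \<delta>) * ennreal e = ennreal (e / \<delta>)"
      using \<delta> e by (simp add: ennreal_mult[symmetric])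
    finally show ?thesis by (simp add: mult_left_mono)
  qed
  have "emeasure lborel ?N \<le> 0"
  proof (rule ennreal_le_epsilon)
    fix e :: real assume "0 < e"
    then show "emeasure lborel ?N \<le> 0 + ennreal e" using small[of "e * \<delta>"] \<delta> by simp
  qed
  then show ?thesis using N by auto
qed

lemma shrinking_target_params_eq:
  "shrinking_target_params x xs \<phi> = {\<beta>. 1 < \<beta> \<and> infinite {n. 1 \<le> n \<and> \<bar>param_orbit x n \<beta> - xs n\<bar> < \<phi> n}}"
  by (simp add: shrinking_target_params_def param_orbit_def)

lemma shrinking_target_params_borel: "shrinking_target_params x xs \<phi> \<in> sets borel"
  unfolding shrinking_target_params_eq infinite_nat_iff_unbounded by measurable

context beta_window
begin

lemma shrinking_target_params_Int_window:
  assumes "in_window u w"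
  shows "shrinking_target_params x xs \<phi> \<inter> {u<..<w}
    = (\<Inter>N. \<Union>n\<in>{max 1 N..}. hits n (xs n) (\<phi> n) u w)"
proof -
  have "1 < \<beta>" if "u < \<beta>" for \<beta> using that in_windowD(1)[OF assms] by simp
  then have "shrinking_target_params x xs \<phi> \<inter> {u<..<w}
      = {\<beta> \<in> {u<..<w}. \<forall>N. \<exists>n\<ge>N. 1 \<le> n \<and> \<bar>f n \<beta> - xs n\<bar> < \<phi> n}"
    unfolding shrinking_target_params_eq infinite_nat_iff_unbounded_le by auto
  also have "\<dots> = (\<Inter>N. \<Union>n\<in>{max 1 N..}. hits n (xs n) (\<phi> n) u w)"
  proof -
    have "(\<exists>n\<ge>N. 1 \<le> n \<and> P n) \<longleftrightarrow> (\<exists>n\<in>{max 1 N..}. P n)" for N and P :: "nat \<Rightarrow> bool"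
      by auto
    then show ?thesis by (auto simp: hits_def)
  qed
  finally show ?thesis .
qed

lemma convergence_case:
  assumes in_window: "in_window u w" and \<phi>: "\<And>n. 1 \<le> n \<Longrightarrow> 0 < \<phi> n" and sum: "summable (\<lambda>n. \<phi> (Suc n))"
  shows "shrinking_target_params x xs \<phi> \<inter> {u<..<w} \<in> null_sets lborel"
proof -
  note u = in_windowD[OF in_window]
  define H where "H n = hits (Suc n) (xs (Suc n)) (\<phi> (Suc n)) u w" for n
  define K where "K = 2 * M / x * (B + A * (w - u))"
  have "summable (\<lambda>n. measure lborel (H n))"
  proof (rule summable_comparison_test')
    show "summable (\<lambda>n. K * \<phi> (Suc n))" using sum by (rule summable_mult)
    fix n :: nat
    have "B / s ^ Suc n \<le> B / 1"
      using B_ge_1 s_gt_1 one_le_power[of s "Suc n"] by (intro divide_left_mono) auto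
    then have "zero_weight (Suc n) u w + 1 / u ^ Suc n \<le> B + A * (w - u)"
      using weight_le_branch_weight[OF in_window, of "Suc n"] branch_weight_le_window[OF in_window, of "Suc n"]
      by linarith
    then have "2 * M / x * \<phi> (Suc n) * (zero_weight (Suc n) u w + 1 / u ^ Suc n)
        \<le> 2 * M / x * \<phi> (Suc n) * (B + A * (w - u))"
      using \<phi>[of "Suc n"] u x_pos by (intro mult_left_mono) auto
    also have "\<dots> = K * \<phi> (Suc n)" by (simp add: K_def)
    finally have "2 * M / x * \<phi> (Suc n) * (zero_weight (Suc n) u w + 1 / u ^ Suc n) \<le> K * \<phi> (Suc n)" .
    then show "norm (measure lborel (H n)) \<le> K * \<phi> (Suc n)"
      using measure_hits_le[OF in_window, of "\<phi> (Suc n)" "Suc n" "xs (Suc n)"] \<phi>[of "Suc n"]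
      by (simp add: H_def)
  qed
  then have "limsup H \<in> null_sets lborel"
    using hits_fmeasurable unfolding H_def
    by (intro borel_cantelli_limsup1) (auto simp: fmeasurable_def)
  moreover have "shrinking_target_params x xs \<phi> \<inter> {u<..<w} \<subseteq> limsup H"
  proof
    fix \<beta> assume "\<beta> \<in> shrinking_target_params x xs \<phi> \<inter> {u<..<w}"
    then have *: "\<exists>n\<ge>max 1 N. \<beta> \<in> hits n (xs n) (\<phi> n) u w" for N
      unfolding shrinking_target_params_Int_window[OF in_window] by (auto simp: Bex_def)
    have "\<exists>n\<ge>N. \<beta> \<in> H n" for N
    proof -
      obtain n where "Suc N \<le> n" "\<beta> \<in> hits n (xs n) (\<phi> n) u w" using *[of "Suc N"] by auto
      then have "N \<le> n - 1" "\<beta> \<in> H (n - 1)" by (auto simp: H_def)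
      then show ?thesis by blast
    qed
    then show "\<beta> \<in> limsup H" by (auto simp: limsup_INF_SUP)
  qed
  moreover have "shrinking_target_params x xs \<phi> \<inter> {u<..<w} \<in> sets lborel"
    using shrinking_target_params_borel by auto
  ultimately show ?thesis using null_sets_subset by blast
qed

text \<open>The quasi-independence bounds hold from some index on that depends on the interval. This does no harm, since
the tails of the divergent series still have arbitrarily large partial sums. The constant \<open>\<delta>\<close> depends only
on \<open>x\<close>, \<open>s\<close> and \<open>M\<close>.\<close>
lemma target_density:
  obtains \<delta> where "0 < \<delta>"
    "\<And>xs \<phi> u w. \<lbrakk>in_window u w; u < w; \<And>n. 1 \<le> n \<Longrightarrow> xs n \<in> {0..1}; \<And>n. 1 \<le> n \<Longrightarrow> \<phi> n \<in> {0<..1};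
      \<not> summable (\<lambda>n. \<phi> (Suc n))\<rbrakk>
      \<Longrightarrow> \<delta> * (w - u) \<le> measure lborel (shrinking_target_params x xs \<phi> \<inter> {u<..<w})"
proof -
  obtain c where c: "0 < c"
    "\<And>u w. in_window u w \<Longrightarrow> u < w \<Longrightarrow> \<exists>N. \<forall>n\<ge>N. c * (w - u) \<le> new_weight n u w"
    using new_weight_lower by blast
  define C where "C = 2 * M / x"
  define c' where "c' = (s\<^sup>2 - 1) / 4 * c"
  define D where "D = C * (B + A * C) * (2 * A)"
  have C: "0 < C" using x_pos M_gt_1 by (simp add: C_def)
  have c': "0 < c'" using c(1) s2_gt by (simp add: c'_def)
  have D: "0 < D" using C A_pos B_ge_1 by (simp add: D_def add_pos_pos)
  define \<delta> where "\<delta> = c'\<^sup>2 / (D * (1 + 2 / (1 - 1 / s)))"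
  show ?thesis
  proof (rule that[of \<delta>])
    have "0 < 1 + 2 / (1 - 1 / s)" using s_gt_1 by (intro add_pos_pos) auto
    then show "0 < \<delta>" using c' D by (simp add: \<delta>_def)
  next
    fix xs \<phi> :: "nat \<Rightarrow> real" and u w
    assume in_window: "in_window u w" and uw: "u < w" and xs: "\<And>n. 1 \<le> n \<Longrightarrow> xs n \<in> {0..1}"
      and \<phi>: "\<And>n. 1 \<le> n \<Longrightarrow> \<phi> n \<in> {0<..1}" and div: "\<not> summable (\<lambda>n. \<phi> (Suc n))"
    define L where "L = w - u"
    have L: "0 < L" using uw by (simp add: L_def)
    define E where "E n = hits n (xs n) (\<phi> n) u w" for n
    have E: "E n \<in> fmeasurable lborel" for n unfolding E_def by (rule hits_fmeasurable)
    have \<phi>0: "0 < \<phi> n" if "1 \<le> n" for n using \<phi>[OF that] by simp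
    obtain N1 where N1: "\<And>n. N1 \<le> n \<Longrightarrow> c * L \<le> new_weight n u w"
      using c(2)[OF in_window uw] unfolding L_def by blast
    obtain N2 where N2: "\<And>n. N2 \<le> n \<Longrightarrow> B / s ^ n \<le> A * L"
      using decay[of "A * L" B] A_pos L by auto
    define N0 where "N0 = max (Suc N1) N2"
    have lower: "c' * L * \<phi> n \<le> measure lborel (E n)" if n: "N0 \<le> n" for n
    proof -
      obtain k where k: "n = Suc k" "N1 \<le> k" using n by (cases n) (auto simp: N0_def)
      have "c' * L * \<phi> n = (s\<^sup>2 - 1) / 4 * \<phi> n * (c * L)" by (simp add: c'_def)
      also have "\<dots> \<le> (s\<^sup>2 - 1) / 4 * \<phi> n * new_weight k u w"
        using N1[OF k(2)] \<phi>0[of n] k s2_gt by (intro mult_left_mono) auto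
      also have "\<dots> \<le> measure lborel (E n)"
        unfolding E_def k(1) using xs[of "Suc k"] \<phi>[of "Suc k"] by (intro measure_hits_ge[OF in_window]) auto
      finally show ?thesis .
    qed
    have upper: "measure lborel (E i \<inter> E j) \<le> D * L * (\<phi> i * \<phi> j + \<phi> j * (1 / s) ^ (j - i))"
      if ij: "N0 \<le> i" "i \<le> j" for i j
    proof -
      have i: "1 \<le> i" "N2 \<le> i" using ij by (auto simp: N0_def)
      have pos: "0 < \<phi> i" "0 < \<phi> j" using \<phi>0 i ij by auto
      have "measure lborel (E i \<inter> E j) \<le> C * \<phi> j * (B / s ^ (j - i) + A * C * \<phi> i) * branch_weight i u w"
        unfolding E_def C_def using pos i ij by (intro measure_hits_Int_le[OF in_window]) auto
      also have "branch_weight i u w \<le> 2 * A * L"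
        using branch_weight_le_window[OF in_window, of i] N2[OF i(2)] by (simp add: L_def)
      also have "C * \<phi> j * (B / s ^ (j - i) + A * C * \<phi> i) * (2 * A * L)
          \<le> C * \<phi> j * ((B + A * C) * (\<phi> i + (1 / s) ^ (j - i))) * (2 * A * L)"
      proof -
        have "B / s ^ (j - i) + A * C * \<phi> i \<le> (B + A * C) * (\<phi> i + (1 / s) ^ (j - i))"
        proof -
          have "0 \<le> B * \<phi> i" "0 \<le> A * C * (1 / s) ^ (j - i)" using B_ge_1 A_pos C pos s_gt_1 by auto
          moreover have "(B + A * C) * (\<phi> i + (1 / s) ^ (j - i))
              = (B / s ^ (j - i) + A * C * \<phi> i) + (B * \<phi> i + A * C * (1 / s) ^ (j - i))"
            by (simp add: algebra_simps add_divide_distrib power_one_over)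
          ultimately show ?thesis by linarith
        qed
        then show ?thesis using C pos A_pos L by (intro mult_right_mono mult_left_mono) auto
      qed
      also have "\<dots> = D * L * (\<phi> i * \<phi> j + \<phi> j * (1 / s) ^ (j - i))"
        by (simp add: D_def algebra_simps)
      finally show ?thesis using C pos A_pos B_ge_1 s_gt_1 by (simp add: mult_left_mono)
    qed
    have tail: "\<delta> * L \<le> measure lborel (\<Union>n\<in>{max 1 N..}. E n)" for N
    proof -
      define K where "K = max (max 1 N) N0"
      have K1: "1 \<le> K" "N0 \<le> K" "max 1 N \<le> K" by (auto simp: K_def)
      have "\<not> summable \<phi>" using div by (simp add: summable_Suc_iff)
      then have "\<not> summable (\<lambda>n. \<phi> (n + K))" by (simp add: summable_iff_shift)
      then have "\<exists>R. 1 < (\<Sum>n<R. \<phi> (n + K))"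
        using summableI_nonneg_bounded[of "\<lambda>n. \<phi> (n + K)" 1] \<phi>0 K1 by (force simp: not_less less_imp_le)
      then obtain R where R: "1 < (\<Sum>n<R. \<phi> (n + K))" by blast
      define I where "I = (\<lambda>n. n + K) ` {..<R}"
      have I: "K \<le> i" if "i \<in> I" for i using that by (auto simp: I_def)
      have "\<delta> * L \<le> measure lborel (\<Union>i\<in>I. E i)"
        unfolding \<delta>_def
      proof (rule measure_Union_ge_quasi_independent[where \<phi> = \<phi>])
        show "1 \<le> (\<Sum>i\<in>I. \<phi> i)" unfolding I_def using R by (subst sum.reindex) auto
        show "0 \<le> \<phi> i" if "i \<in> I" for i using I[OF that] K1 \<phi>0[of i] by simp
        show "c' * L * \<phi> i \<le> measure lborel (E i)" if "i \<in> I" for i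
          using I[OF that] K1 by (intro lower) auto
        show "measure lborel (E i \<inter> E j) \<le> D * L * (\<phi> i * \<phi> j + \<phi> j * (1 / s) ^ (j - i))"
          if "i \<in> I" "j \<in> I" "i \<le> j" for i j using I[OF that(1)] K1 that by (intro upper) auto
      qed (use E c' D L s_gt_1 in \<open>auto simp: I_def\<close>)
      also have "\<dots> \<le> measure lborel (\<Union>n\<in>{max 1 N..}. E n)"
      proof (rule measure_mono_fmeasurable)
        show "(\<Union>i\<in>I. E i) \<subseteq> (\<Union>n\<in>{max 1 N..}. E n)" using I K1(3) by (force dest: I)
        show "(\<Union>n\<in>{max 1 N..}. E n) \<in> fmeasurable lborel"
          by (rule fmeasurableI2[of "{u<..<w}"]) (use hits_borel in \<open>auto simp: E_def hits_def\<close>)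
      qed (use hits_borel in \<open>auto simp: E_def\<close>)
      finally show ?thesis .
    qed
    have "(\<lambda>N. measure lborel (\<Union>n\<in>{max 1 N..}. E n)) \<longlonglongrightarrow> measure lborel (\<Inter>N. \<Union>n\<in>{max 1 N..}. E n)"
    proof (rule Lim_measure_decseq)
      show "range (\<lambda>N. \<Union>n\<in>{max 1 N..}. E n) \<subseteq> sets lborel"
        using hits_borel by (auto simp: E_def)
      show "decseq (\<lambda>N. \<Union>n\<in>{max 1 N..}. E n)" by (fastforce simp: decseq_def)
      fix N
      have "(\<Union>n\<in>{max 1 N..}. E n) \<in> fmeasurable lborel"
        by (rule fmeasurableI2[of "{u<..<w}"]) (use hits_borel in \<open>auto simp: E_def hits_def\<close>)
      then show "emeasure lborel (\<Union>n\<in>{max 1 N..}. E n) \<noteq> \<infinity>" by (auto simp: fmeasurable_def)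
    qed
    then have "\<delta> * L \<le> measure lborel (\<Inter>N. \<Union>n\<in>{max 1 N..}. E n)"
      by (rule LIMSEQ_le_const) (use tail in auto)
    then show "\<delta> * (w - u) \<le> measure lborel (shrinking_target_params x xs \<phi> \<inter> {u<..<w})"
      unfolding shrinking_target_params_Int_window[OF in_window] E_def L_def .
  qed
qed

lemma divergence_case:
  assumes "in_window u w" "\<And>n. 1 \<le> n \<Longrightarrow> xs n \<in> {0..1}" "\<And>n. 1 \<le> n \<Longrightarrow> \<phi> n \<in> {0<..1}"
    "\<not> summable (\<lambda>n. \<phi> (Suc n))"
  shows "{u<..<w} - shrinking_target_params x xs \<phi> \<in> null_sets lborel"
proof -
  obtain \<delta> where \<delta>: "0 < \<delta>" "\<And>xs \<phi> u w. \<lbrakk>in_window u w; u < w; \<And>n. 1 \<le> n \<Longrightarrow> xs n \<in> {0..1};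
      \<And>n. 1 \<le> n \<Longrightarrow> \<phi> n \<in> {0<..1}; \<not> summable (\<lambda>n. \<phi> (Suc n))\<rbrakk>
      \<Longrightarrow> \<delta> * (w - u) \<le> measure lborel (shrinking_target_params x xs \<phi> \<inter> {u<..<w})"
    using target_density by blast
  show ?thesis
  proof (rule null_set_if_dense_on_intervals[OF shrinking_target_params_borel \<delta>(1)])
    fix u' w' assume "u \<le> u'" "u' < w'" "w' \<le> w"
    then show "\<delta> * (w' - u') \<le> measure lborel (shrinking_target_params x xs \<phi> \<inter> {u'<..<w'})"
      using assms by (intro \<delta>(2)) (auto simp: in_window_def)
  qed
qed

end

lemma null_set_if_null_on_windows:
  fixes S :: "real set"
  assumes S: "S \<subseteq> {1<..}"
    and in_window: "\<And>s M. 1 < s \<Longrightarrow> s\<^sup>2 < M \<Longrightarrow> S \<inter> {s\<^sup>2<..<M} \<in> null_sets lborel"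
  shows "S \<in> null_sets lebesgue"
proof -
  define s where "s k = 1 + 1 / real (Suc k)" for k
  define W where "W k = {(s k)\<^sup>2<..<(s k)\<^sup>2 + real (Suc k)}" for k
  have "(\<Union>k. S \<inter> W k) \<in> null_sets lborel"
    by (intro null_sets_UN) (auto simp: W_def s_def intro!: in_window)
  moreover have "S \<subseteq> (\<Union>k. S \<inter> W k)"
  proof
    fix \<beta> assume \<beta>: "\<beta> \<in> S"
    then have "1 < \<beta>" using S by auto
    have "(\<lambda>k. (1 + 1 / real (Suc k))\<^sup>2) \<longlonglongrightarrow> (1 + 0)\<^sup>2"
      by (intro tendsto_intros LIMSEQ_inverse_real_of_nat[unfolded inverse_eq_divide])
    then have "eventually (\<lambda>k. (s k)\<^sup>2 < \<beta>) sequentially"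
      using \<open>1 < \<beta>\<close> unfolding s_def by (intro order_tendstoD(2)) auto
    moreover have "eventually (\<lambda>k. \<beta> < real (Suc k)) sequentially"
      using filterlim_real_sequentially
      by (intro eventually_compose_filterlim[OF eventually_gt_at_top]
          filterlim_compose[OF _ filterlim_Suc])
    ultimately have "eventually (\<lambda>k. \<beta> \<in> W k) sequentially"
      by eventually_elim (auto simp: W_def add_pos_nonneg intro: less_le_trans)
    then obtain k where "\<beta> \<in> W k" by (auto simp: eventually_sequentially)
    with \<beta> show "\<beta> \<in> (\<Union>k. S \<inter> W k)" by blast
  qed
  ultimately have "(\<Union>k. S \<inter> W k) = S" "(\<Union>k. S \<inter> W k) \<in> null_sets lborel" by auto
  then show ?thesis by (simp add: null_sets_completionI)
qed

theorem theorem1p2: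
  fixes xs \<phi> :: "nat \<Rightarrow> real" and x :: real
  assumes "\<And>n. n \<ge> 1 \<Longrightarrow> xs n \<in> {0..1}"
    and "\<And>n. n \<ge> 1 \<Longrightarrow> \<phi> n \<in> {0<..1}"
    and "x \<in> {0<..1}"
  shows "(summable (\<lambda>n. \<phi> (Suc n)) \<longrightarrow>
            shrinking_target_params x xs \<phi> \<in> null_sets lebesgue) \<and>
         (\<not> summable (\<lambda>n. \<phi> (Suc n)) \<longrightarrow>
            {1<..} - shrinking_target_params x xs \<phi> \<in> null_sets lebesgue)"
proof -
  have loc: "beta_window x s M" and window: "beta_window.in_window s M (s\<^sup>2) M" if "1 < s" "s\<^sup>2 < M" for s M
  proof -
    have "1 < s\<^sup>2" using that by (simp add: one_less_power)
    with that have "1 < M" by linarith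
    then show loc: "beta_window x s M" using that(1) assms(3) by unfold_locales auto
    show "beta_window.in_window s M (s\<^sup>2) M" using that by (simp add: beta_window.in_window_def[OF loc])
  qed
  let ?E = "shrinking_target_params x xs \<phi>"
  show ?thesis
  proof (intro conjI impI)
    assume "summable (\<lambda>n. \<phi> (Suc n))"
    then show "?E \<in> null_sets lebesgue"
      using assms(2) loc window
      by (intro null_set_if_null_on_windows beta_window.convergence_case)
        (auto simp: shrinking_target_params_def)
  next
    assume div: "\<not> summable (\<lambda>n. \<phi> (Suc n))"
    show "{1<..} - ?E \<in> null_sets lebesgue"
    proof (rule null_set_if_null_on_windows)
      fix s M :: real assume sM: "1 < s" "s\<^sup>2 < M"
      have "1 < s\<^sup>2" using sM by (simp add: one_less_power)
      then have "({1<..} - ?E) \<inter> {s\<^sup>2<..<M} = {s\<^sup>2<..<M} - ?E" by auto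
      then show "({1<..} - ?E) \<inter> {s\<^sup>2<..<M} \<in> null_sets lborel"
        using beta_window.divergence_case[OF loc[OF sM] window[OF sM] assms(1,2) div] by simp
    qed auto
  qed
qed

end
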